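(* There exists an absolute constant $C>0$ such that, for every $n\ge 1$, every convex body $K\subseteq\mathbb{R}^n$ and every $x\in\operatorname{int}(K)$, $$q_K(x)\ \geq\ \frac{C}{\sqrt n}\,e^{-\Lambda_K^*(x)}.$$ Equivalently, with an absolute constant $C'>0$ (independent of $n$, $K$ and $x$), for every $n\ge 1$, every convex body $K\subseteq\mathbb{R}^n$ and every $x\in\operatorname{int}(K)$, $$\Lambda_K^*(x)\ \leq\ -\log q_K(x)\ \leq\ \Lambda_K^*(x)+\tfrac12\log n+C'.$$
   Context: A convex body in $\mathbb{R}^n$ is a compact convex set with non-empty interior. For a convex body $K$, $\mu_K$ is the uniform probability measure on $K$. For a Borel probability measure $\mu$ on $\mathbb{R}^n$, $\Lambda_\mu(\theta)=\log\int_{\mathbb{R}^n}e^{\langle\theta,x\rangle}\,d\mu(x)$ for $\theta\in\mathbb{R}^n$; the Cramér transform of $\mu$ is $\Lambda_\mu^*(x)=\sup_{\theta\in\mathbb{R}^n}\{\langle\theta,x\rangle-\Lambda_\mu(\theta)\}$; and the Tukey half-space depth is $q_\mu(x)=\inf\{\mu(H): H\subseteq\mathbb{R}^n\text{ a closed half-space containing }x\}$. Write $\Lambda_K^*=\Lambda_{\mu_K}^*$ and $q_K=q_{\mu_K}$. *)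

theory Defs
  imports "HOL-Analysis.Analysis"
begin

text \<open>
  The constants in the theorem do not depend on the dimension, so the dimension has to be
  quantified inside the formula. Hence $\mathbb{R}^n$ is the set \<^term>\<open>{..<n} \<rightarrow>\<^sub>E (UNIV :: real set)\<close>
  of real functions on \<^term>\<open>{..<n}\<close> (with value \<^term>\<open>undefined\<close> elsewhere). It is the
  carrier both of the product topology and of the product of the Borel-Lebesgue measures, whose
  measurable sets are the Borel sets.
\<close>

abbreviation Rn :: "nat \<Rightarrow> (nat \<Rightarrow> real) set" where
  "Rn n \<equiv> {..<n} \<rightarrow>\<^sub>E UNIV"

abbreviation Rn_topology :: "nat \<Rightarrow> (nat \<Rightarrow> real) topology" where
  "Rn_topology n \<equiv> powertop_real {..<n}"

abbreviation lborel_Rn :: "nat \<Rightarrow> (nat \<Rightarrow> real) measure" where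
  "lborel_Rn n \<equiv> PiM {..<n} (\<lambda>_. lborel)"

definition inner_Rn :: "nat \<Rightarrow> (nat \<Rightarrow> real) \<Rightarrow> (nat \<Rightarrow> real) \<Rightarrow> real" where
  "inner_Rn n x y = (\<Sum>i<n. x i * y i)"

definition convex_Rn :: "nat \<Rightarrow> (nat \<Rightarrow> real) set \<Rightarrow> bool" where
  "convex_Rn n S \<longleftrightarrow>
     (\<forall>x\<in>S. \<forall>y\<in>S. \<forall>u\<ge>0. \<forall>v\<ge>0. u + v = 1 \<longrightarrow> (\<lambda>i\<in>{..<n}. u * x i + v * y i) \<in> S)"

definition convex_body :: "nat \<Rightarrow> (nat \<Rightarrow> real) set \<Rightarrow> bool" where
  "convex_body n K \<longleftrightarrow>
     compactin (Rn_topology n) K \<and> convex_Rn n K \<and> Rn_topology n interior_of K \<noteq> {}"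

definition uniform_prob :: "nat \<Rightarrow> (nat \<Rightarrow> real) set \<Rightarrow> (nat \<Rightarrow> real) measure" where
  "uniform_prob n K = uniform_measure (lborel_Rn n) K"

text \<open>
  Logarithm and exponential on the extended reals, with $\log 0 = -\infty$, $\log\infty = \infty$,
  $e^{-\infty} = 0$ and $e^{\infty} = \infty$. (The value of \<open>elog\<close> at negative arguments is irrelevant.)
\<close>

definition elog :: "ereal \<Rightarrow> ereal" where
  "elog a = (case a of ereal r \<Rightarrow> if r > 0 then ereal (ln r) else -\<infinity> | PInfty \<Rightarrow> \<infinity> | MInfty \<Rightarrow> -\<infinity>)"

definition eexp :: "ereal \<Rightarrow> ereal" where
  "eexp a = (case a of ereal r \<Rightarrow> ereal (exp r) | PInfty \<Rightarrow> \<infinity> | MInfty \<Rightarrow> 0)"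

definition log_laplace :: "nat \<Rightarrow> (nat \<Rightarrow> real) measure \<Rightarrow> (nat \<Rightarrow> real) \<Rightarrow> ereal" where
  "log_laplace n \<mu> \<theta> = elog (enn2ereal (\<integral>\<^sup>+x. ennreal (exp (inner_Rn n \<theta> x)) \<partial>\<mu>))"

definition cramer_transform :: "nat \<Rightarrow> (nat \<Rightarrow> real) measure \<Rightarrow> (nat \<Rightarrow> real) \<Rightarrow> ereal" where
  "cramer_transform n \<mu> x = (SUP \<theta>\<in>Rn n. ereal (inner_Rn n \<theta> x) - log_laplace n \<mu> \<theta>)"

definition closed_halfspace :: "nat \<Rightarrow> (nat \<Rightarrow> real) set \<Rightarrow> bool" where
  "closed_halfspace n H \<longleftrightarrow>
     (\<exists>\<theta>\<in>Rn n. \<exists>a. (\<exists>i<n. \<theta> i \<noteq> 0) \<and> H = {y \<in> Rn n. inner_Rn n \<theta> y \<ge> a})"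

definition tukey_depth :: "nat \<Rightarrow> (nat \<Rightarrow> real) measure \<Rightarrow> (nat \<Rightarrow> real) \<Rightarrow> real" where
  "tukey_depth n \<mu> x = (INF H\<in>{H. closed_halfspace n H \<and> x \<in> H}. measure \<mu> H)"

abbreviation cramer_body :: "nat \<Rightarrow> (nat \<Rightarrow> real) set \<Rightarrow> (nat \<Rightarrow> real) \<Rightarrow> ereal" where
  "cramer_body n K \<equiv> cramer_transform n (uniform_prob n K)"

abbreviation tukey_body :: "nat \<Rightarrow> (nat \<Rightarrow> real) set \<Rightarrow> (nat \<Rightarrow> real) \<Rightarrow> real" where
  "tukey_body n K \<equiv> tukey_depth n (uniform_prob n K)"

end

theory Submission
  imports Defs "HOL-Probability.Distributions"
begin

text \<open>
  Fix a half-space \<open>{y. \<langle>\<theta>, y\<rangle> \<ge> a}\<close> containing \<open>x\<close>, put \<open>s = \<langle>\<theta>, x\<rangle>\<close>, and let \<open>G u\<close> be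
  the volume of the cap of the points \<open>y\<close> of \<open>K\<close> with \<open>\<langle>\<theta>, y\<rangle> \<ge> u\<close>. The whole proof rests on
  the Brunn--Minkowski inequality: \<open>G\<close> to the power \<open>1 / n\<close> is concave where \<open>G\<close> is positive
  (\<open>brunn_minkowski_caps\<close>). A supporting line at \<open>s\<close> therefore gives a rate \<open>k \<ge> 0\<close> with
  \<open>G u \<le> G s (1 - k (u - s))\<^sup>n\<close> for all \<open>u\<close>, the bracket being cut off at \<open>0\<close>
  (\<open>cap_volume_supporting_line\<close>). Integrating this bound against the density \<open>t e\<^bsup>t (u - s)\<^esup>\<close> yields,
  for the exponent \<open>t = n k\<close>, a Gamma integral and hence
  \[ \int_K e^{t (\langle\theta, y\rangle - s)}\, dy \le \frac{n!\, e^n}{n^n}\, G(s) \le e \sqrt n\, G(s) \]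
  (\<open>exists_chernoff_exponent\<close>); if \<open>k = 0\<close>, the cap at \<open>s\<close> has the volume of \<open>K\<close> and \<open>t = 0\<close> will do. So Chernoff's bound for the cap is sharp up to the factor \<open>e \<surd>n\<close>.
  After division by the volume of \<open>K\<close>, the left-hand side is the exponential of
  \<open>\<Lambda> (t \<theta>) - \<langle>t \<theta>, x\<rangle>\<close>, which is at least \<open>e\<close> to the power \<open>- \<Lambda>\<^sup>* x\<close>, while \<open>G s\<close>
  divided by the volume of \<open>K\<close> is at most the measure of the half-space. This proves the lower bound for
  the depth with \<open>C = 1 / e\<close>, and after taking logarithms the upper bound with \<open>C' = 1\<close>. The remaining
  inequality is Markov's.

  Brunn--Minkowski comes from Prekopa's theorem that marginals of log-concave functions are log-concave
  (\<open>prekopa\<close>). It is proved by induction on the number of integrated coordinates. Since the functions that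
  occur are log-concave, their one-dimensional level sets are intervals, and the one-dimensional case
  (\<open>prekopa_leindler_real\<close>) needs sums of intervals only. It is applied to the indicators of the caps of
  the dilates of \<open>K\<close>, with the dilation factor as an additional parameter.
\<close>

section \<open>The Prekopa--Leindler inequality on the line\<close>

text \<open>
  Up to endpoints, a bounded convex subset of the line is the interval between its infimum and its
  supremum, and the combined set contains the open interval between the combined infimum and the
  combined supremum. A point \<open>z\<close> of it lies between a combination of two points near the infima and
  one of two points near the suprema; sliding both points along \<open>A\<close> and \<open>B\<close> at the same rate
  reaches \<open>z\<close>.
\<close>

lemma brunn_minkowski_intervals:
  fixes A B S :: "real set" and l :: real
  assumes A: "convex A" "bounded A" "A \<noteq> {}" and B: "convex B" "bounded B" "B \<noteq> {}"
    and l: "0 < l" "l < 1"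
    and S: "S \<in> sets borel" "\<And>x y. x \<in> A \<Longrightarrow> y \<in> B \<Longrightarrow> (1 - l) * x + l * y \<in> S"
  shows "ennreal (1 - l) * emeasure lborel A + ennreal l * emeasure lborel B \<le> emeasure lborel S"
proof -
  have bA: "bdd_above A" "bdd_below A" and bB: "bdd_above B" "bdd_below B"
    using A(2) B(2) by (auto simp: bounded_imp_bdd_above bounded_imp_bdd_below)
  have iA: "Inf A \<le> Sup A" and iB: "Inf B \<le> Sup B"
    using A B bA bB by (auto simp: cInf_le_cSup)
  have eA: "emeasure lborel A \<le> ennreal (Sup A - Inf A)"
  proof -
    have "A \<subseteq> {Inf A..Sup A}" using bA by (auto intro: cInf_lower cSup_upper)
    then have "emeasure lborel A \<le> emeasure lborel {Inf A..Sup A}" by (intro emeasure_mono) auto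
    then show ?thesis using iA by simp
  qed
  have eB: "emeasure lborel B \<le> ennreal (Sup B - Inf B)"
  proof -
    have "B \<subseteq> {Inf B..Sup B}" using bB by (auto intro: cInf_lower cSup_upper)
    then have "emeasure lborel B \<le> emeasure lborel {Inf B..Sup B}" by (intro emeasure_mono) auto
    then show ?thesis using iB by simp
  qed
  define m M where "m = (1 - l) * Inf A + l * Inf B" and "M = (1 - l) * Sup A + l * Sup B"
  have sub: "{m<..<M} \<subseteq> S"
  proof
    fix z assume z: "z \<in> {m<..<M}"
    obtain x0 y0 where 0: "x0 \<in> A" "y0 \<in> B" "(1 - l) * x0 + l * y0 < z"
    proof -
      have "Inf A < Inf A + (z - m)" using z by auto
      then obtain x0 where x0: "x0 \<in> A" "x0 < Inf A + (z - m)"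
        using A(3) bA(2) cInf_less_iff by metis
      have "Inf B < Inf B + (z - m)" using z by auto
      then obtain y0 where y0: "y0 \<in> B" "y0 < Inf B + (z - m)"
        using B(3) bB(2) cInf_less_iff by metis
      have "(1 - l) * x0 + l * y0 < (1 - l) * (Inf A + (z - m)) + l * (Inf B + (z - m))"
        using x0 y0 l by (intro add_strict_mono mult_strict_left_mono) auto
      also have "\<dots> = z" by (simp add: m_def algebra_simps)
      finally show ?thesis using x0 y0 that by blast
    qed
    obtain x1 y1 where 1: "x1 \<in> A" "y1 \<in> B" "z < (1 - l) * x1 + l * y1"
    proof -
      have "Sup A - (M - z) < Sup A" using z by auto
      then obtain x1 where x1: "x1 \<in> A" "Sup A - (M - z) < x1"
        using A(3) bA(1) less_cSup_iff by metis
      have "Sup B - (M - z) < Sup B" using z by auto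
      then obtain y1 where y1: "y1 \<in> B" "Sup B - (M - z) < y1"
        using B(3) bB(1) less_cSup_iff by metis
      have "(1 - l) * (Sup A - (M - z)) + l * (Sup B - (M - z)) < (1 - l) * x1 + l * y1"
        using x1 y1 l by (intro add_strict_mono mult_strict_left_mono) auto
      moreover have "(1 - l) * (Sup A - (M - z)) + l * (Sup B - (M - z)) = z"
        by (simp add: M_def algebra_simps)
      ultimately show ?thesis using x1 y1 that by auto
    qed
    define w0 w1 where "w0 = (1 - l) * x0 + l * y0" and "w1 = (1 - l) * x1 + l * y1"
    define a where "a = (z - w0) / (w1 - w0)"
    have "w0 < z" "z < w1" using 0 1 by (auto simp: w0_def w1_def)
    then have a: "0 \<le> a" "a \<le> 1" "a * (w1 - w0) = z - w0"
      unfolding a_def by auto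
    have z': "z = (1 - a) * w0 + a * w1" using a(3) by (simp add: algebra_simps)
    have "(1 - a) * x0 + a * x1 \<in> A" "(1 - a) * y0 + a * y1 \<in> B"
      using A(1) B(1) 0 1 a by (auto simp: convex_alt)
    then have "(1 - l) * ((1 - a) * x0 + a * x1) + l * ((1 - a) * y0 + a * y1) \<in> S"
      by (rule S(2))
    also have "(1 - l) * ((1 - a) * x0 + a * x1) + l * ((1 - a) * y0 + a * y1) = z"
      unfolding z' w0_def w1_def by (simp add: algebra_simps)
    finally show "z \<in> S" .
  qed
  have "ennreal (1 - l) * emeasure lborel A + ennreal l * emeasure lborel B
     \<le> ennreal (1 - l) * ennreal (Sup A - Inf A) + ennreal l * ennreal (Sup B - Inf B)"
    by (intro add_mono mult_left_mono eA eB) auto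
  also have "\<dots> = ennreal ((1 - l) * (Sup A - Inf A) + l * (Sup B - Inf B))"
    using l iA iB by (simp add: ennreal_mult[symmetric] ennreal_plus[symmetric] del: ennreal_plus)
  also have "(1 - l) * (Sup A - Inf A) + l * (Sup B - Inf B) = M - m"
    by (simp add: M_def m_def algebra_simps)
  also have "\<dots> = emeasure lborel {m<..<M}"
  proof -
    have "m \<le> M" unfolding m_def M_def using l iA iB by (intro add_mono mult_left_mono) auto
    then show ?thesis by simp
  qed
  also have "\<dots> \<le> emeasure lborel S" using sub S(1) by (intro emeasure_mono) auto
  finally show ?thesis .
qed

text \<open>
  Fubini for the region below the graph of \<open>f / k\<close>, cut off at height \<open>1\<close>. The truncation is what
  the larger function \<open>h\<close> of the Prekopa--Leindler inequality needs: it may exceed the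
  normalisation \<open>k\<close> that is dictated by the two others.
\<close>

lemma layer_cake_truncated:
  fixes f :: "real \<Rightarrow> real" and k :: real
  assumes [measurable]: "f \<in> borel_measurable borel" and k: "0 < k"
  shows "(\<integral>\<^sup>+t. indicator {0<..<1} t * emeasure lborel {x. t * k < f x} \<partial>lborel)
       = (\<integral>\<^sup>+x. ennreal (min 1 (f x / k)) \<partial>lborel)"
proof -
  have "(\<integral>\<^sup>+t. indicator {0<..<1} t * emeasure lborel {x. t * k < f x} \<partial>lborel)
      = (\<integral>\<^sup>+t. \<integral>\<^sup>+x. indicator {0<..<1} t * indicator {x. t * k < f x} x \<partial>lborel \<partial>lborel)"
    by (intro nn_integral_cong) (simp add: nn_integral_cmult)
  also have "\<dots> = (\<integral>\<^sup>+x. \<integral>\<^sup>+t. indicator {0<..<1} t * indicator {x. t * k < f x} x \<partial>lborel \<partial>lborel)"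
    by (rule lborel_pair.Fubini') (auto simp: split_beta' indicator_def)
  also have "\<dots> = (\<integral>\<^sup>+x. ennreal (min 1 (f x / k)) \<partial>lborel)"
  proof (intro nn_integral_cong)
    fix x :: real
    have "(\<integral>\<^sup>+t. indicator {0<..<1} t * indicator {x. t * k < f x} x \<partial>lborel)
        = (\<integral>\<^sup>+t. indicator {0<..<min 1 (f x / k)} t \<partial>lborel)"
      using k by (intro nn_integral_cong) (auto simp: indicator_def field_simps)
    also have "\<dots> = ennreal (min 1 (f x / k))"
      by (cases "0 \<le> f x / k") (auto simp: ennreal_neg)
    finally show "(\<integral>\<^sup>+t. indicator {0<..<1} t * indicator {x. t * k < f x} x \<partial>lborel) = ennreal (min 1 (f x / k))" .
  qed
  finally show ?thesis .
qed

lemma layer_cake_normalised: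
  fixes f :: "real \<Rightarrow> real" and k :: real
  assumes [measurable]: "f \<in> borel_measurable borel" and k: "0 < k" and "\<And>x. f x \<le> k"
  shows "(\<integral>\<^sup>+t. indicator {0<..<1} t * emeasure lborel {x. t * k < f x} \<partial>lborel)
       = (\<integral>\<^sup>+x. ennreal (f x) \<partial>lborel) / ennreal k"
proof -
  have "(\<integral>\<^sup>+t. indicator {0<..<1} t * emeasure lborel {x. t * k < f x} \<partial>lborel)
      = (\<integral>\<^sup>+x. ennreal (f x) / ennreal k \<partial>lborel)"
    unfolding layer_cake_truncated[OF assms(1,2)]
  proof (intro nn_integral_cong)
    fix x
    have "min 1 (f x / k) = f x / k" using assms(3)[of x] k by (simp add: min_def)
    then show "ennreal (min 1 (f x / k)) = ennreal (f x) / ennreal k"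
      using k by (cases "0 \<le> f x") (auto simp: divide_ennreal ennreal_neg divide_nonpos_pos)
  qed
  also have "\<dots> = (\<integral>\<^sup>+x. ennreal (f x) \<partial>lborel) / ennreal k"
    by (rule nn_integral_divide) simp
  finally show ?thesis .
qed

text \<open>
  After dividing \<open>f\<close> and \<open>g\<close> by their suprema \<open>A\<close> and \<open>B\<close>, the level sets at every height
  \<open>t < 1\<close> are non-empty, so the one-dimensional Brunn--Minkowski inequality compares them with the level
  set of \<open>h / k\<close>, where \<open>k\<close> is the geometric mean of \<open>A\<close> and \<open>B\<close>. Integrating over \<open>t\<close> gives
  the inequality with an arithmetic mean, which is stronger than the one with a geometric mean. Convex level
  sets make it possible to use intervals only.
\<close>

lemma prekopa_leindler_real:
  fixes f g h :: "real \<Rightarrow> real" and l :: real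
  assumes l: "0 < l" "l < 1"
    and [measurable]: "f \<in> borel_measurable borel" "g \<in> borel_measurable borel" "h \<in> borel_measurable borel"
    and f0: "\<And>x. 0 \<le> f x" and g0: "\<And>x. 0 \<le> g x" and h0: "\<And>x. 0 \<le> h x"
    and fM: "\<And>x. f x \<le> M" and gM: "\<And>x. g x \<le> M'"
    and fR: "\<And>x. f x \<noteq> 0 \<Longrightarrow> \<bar>x\<bar> \<le> R" and gR: "\<And>x. g x \<noteq> 0 \<Longrightarrow> \<bar>x\<bar> \<le> R'"
    and fc: "\<And>c. 0 < c \<Longrightarrow> convex {x. c < f x}" and gc: "\<And>c. 0 < c \<Longrightarrow> convex {x. c < g x}"
    and hfin: "(\<integral>\<^sup>+x. h x \<partial>lborel) < \<infinity>"
    and fgh: "\<And>x y. f x powr (1 - l) * g y powr l \<le> h ((1 - l) * x + l * y)"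
  shows "enn2real (\<integral>\<^sup>+x. f x \<partial>lborel) powr (1 - l) * enn2real (\<integral>\<^sup>+x. g x \<partial>lborel) powr l
     \<le> enn2real (\<integral>\<^sup>+x. h x \<partial>lborel)"
proof -
  define If where "If = enn2real (\<integral>\<^sup>+x. f x \<partial>lborel)"
  define Ig where "Ig = enn2real (\<integral>\<^sup>+x. g x \<partial>lborel)"
  define Ih where "Ih = enn2real (\<integral>\<^sup>+x. h x \<partial>lborel)"
  show ?thesis
  proof (cases "If = 0 \<or> Ig = 0")
    case True
    then show ?thesis unfolding If_def Ig_def by auto
  next
    case False
    then have If: "If > 0" and Ig: "Ig > 0"
      unfolding If_def Ig_def using enn2real_nonneg by (auto simp: less_le)
    have ef: "(\<integral>\<^sup>+x. f x \<partial>lborel) = ennreal If"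
      using False unfolding If_def by (metis enn2real_top ennreal_enn2real top.not_eq_extremum)
    have eg: "(\<integral>\<^sup>+x. g x \<partial>lborel) = ennreal Ig"
      using False unfolding Ig_def by (metis enn2real_top ennreal_enn2real top.not_eq_extremum)
    have eh: "(\<integral>\<^sup>+x. h x \<partial>lborel) = ennreal Ih"
      using hfin unfolding Ih_def by (simp add: less_top)
    have bf: "bdd_above (range f)" "bdd_above (range g)"
      using fM gM by (auto intro!: bdd_aboveI)
    define A B where "A = Sup (range f)" and "B = Sup (range g)"
    have fA: "f x \<le> A" for x unfolding A_def using bf by (auto intro: cSup_upper)
    have gB: "g x \<le> B" for x unfolding B_def using bf by (auto intro: cSup_upper)
    have A: "A > 0"
    proof (rule ccontr)
      assume "\<not> A > 0"
      then have "f x = 0" for x using fA[of x] f0[of x] by linarith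
      then show False using If unfolding If_def by simp
    qed
    have B: "B > 0"
    proof (rule ccontr)
      assume "\<not> B > 0"
      then have "g x = 0" for x using gB[of x] g0[of x] by linarith
      then show False using Ig unfolding Ig_def by simp
    qed
    define k where "k = A powr (1 - l) * B powr l"
    have k: "k > 0" using A B by (simp add: k_def)
    have tk: "t * k = (t * A) powr (1 - l) * (t * B) powr l" if "0 < t" for t
    proof -
      have "t = t powr (1 - l) * t powr l" using that by (simp add: powr_add[symmetric])
      then show ?thesis using A B that by (simp add: k_def powr_mult)
    qed
    have level: "ennreal (1 - l) * emeasure lborel {x. t * A < f x}
        + ennreal l * emeasure lborel {x. t * B < g x} \<le> emeasure lborel {x. t * k < h x}"
      if t: "0 < t" "t < 1" for t
    proof (rule brunn_minkowski_intervals)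
      have tA: "0 < t * A" "0 < t * B" using t A B by auto
      show "convex {x. t * A < f x}" "convex {x. t * B < g x}" using fc gc tA by auto
      have "{x. t * A < f x} \<subseteq> {-R..R}" 
      proof
        fix x assume "x \<in> {x. t * A < f x}"
        then have "f x \<noteq> 0" using tA by auto
        then show "x \<in> {-R..R}" using fR[of x] by auto
      qed
      then show "bounded {x. t * A < f x}" using bounded_subset bounded_closed_interval by blast
      have "{x. t * B < g x} \<subseteq> {-R'..R'}" 
      proof
        fix x assume "x \<in> {x. t * B < g x}"
        then have "g x \<noteq> 0" using tA by auto
        then show "x \<in> {-R'..R'}" using gR[of x] by auto
      qed
      then show "bounded {x. t * B < g x}" using bounded_subset bounded_closed_interval by blast
      have "t * A < Sup (range f)" using t A by (simp add: A_def)
      then show "{x. t * A < f x} \<noteq> {}" using bf by (subst (asm) less_cSup_iff) auto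
      have "t * B < Sup (range g)" using t B by (simp add: B_def)
      then show "{x. t * B < g x} \<noteq> {}" using bf by (subst (asm) less_cSup_iff) auto
      show "0 < l" "l < 1" by fact+
      show "{x. t * k < h x} \<in> sets borel" by measurable
      fix x y assume xy: "x \<in> {x. t * A < f x}" "y \<in> {x. t * B < g x}"
      have "t * k < f x powr (1 - l) * g y powr l"
        unfolding tk[OF t(1)] using xy tA l
        by (intro mult_strict_mono powr_less_mono2) auto
      also note fgh
      finally show "(1 - l) * x + l * y \<in> {x. t * k < h x}" by simp
    qed
    have meas: "(\<lambda>t. indicator {0<..<1} t * emeasure lborel {x. t * c < u x}) \<in> borel_measurable lborel"
      if [measurable]: "u \<in> borel_measurable borel" for c and u :: "real \<Rightarrow> real"
    proof -
      have "(\<lambda>t::real. \<integral>\<^sup>+x. indicator {0<..<1} t * indicator {z. t * c < u z} x \<partial>lborel) \<in> borel_measurable lborel"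
        by (intro lborel.borel_measurable_nn_integral) (auto simp: split_beta' indicator_def)
      then show ?thesis by (simp add: nn_integral_cmult)
    qed
    note [measurable] = meas
    have "ennreal (1 - l) * (ennreal If / ennreal A) + ennreal l * (ennreal Ig / ennreal B)
       = (\<integral>\<^sup>+t. ennreal (1 - l) * (indicator {0<..<1} t * emeasure lborel {x. t * A < f x})
               + ennreal l * (indicator {0<..<1} t * emeasure lborel {x. t * B < g x}) \<partial>lborel)"
      using layer_cake_normalised[of f A] layer_cake_normalised[of g B] fA gB A B ef eg
      by (subst nn_integral_add) (auto simp: nn_integral_cmult)
    also have "\<dots> \<le> (\<integral>\<^sup>+t. indicator {0<..<1} t * emeasure lborel {x. t * k < h x} \<partial>lborel)"
      using level by (intro nn_integral_mono) (auto simp: indicator_def)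
    also have "\<dots> = (\<integral>\<^sup>+x. ennreal (min 1 (h x / k)) \<partial>lborel)"
      by (rule layer_cake_truncated) (use k in auto)
    also have "\<dots> \<le> (\<integral>\<^sup>+x. ennreal (h x) / ennreal k \<partial>lborel)"
      using k h0 by (intro nn_integral_mono) (auto simp: divide_ennreal intro!: ennreal_leI)
    also have "\<dots> = ennreal Ih / ennreal k"
      using eh by (subst nn_integral_divide) auto
    finally have "ennreal ((1 - l) * (If / A) + l * (Ig / B)) \<le> ennreal (Ih / k)"
      using A B k If Ig l
      by (simp add: divide_ennreal ennreal_mult[symmetric] ennreal_plus[symmetric] Ih_def del: ennreal_plus)
    then have le: "(1 - l) * (If / A) + l * (Ig / B) \<le> Ih / k"
      using k by (subst (asm) ennreal_le_iff) (auto simp: Ih_def)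
    have "(If / A) powr (1 - l) * (Ig / B) powr l \<le> (1 - l) * (If / A) + l * (Ig / B)"
      using l A B If Ig by (intro Youngs_inequality_0) auto
    then have "(If / A) powr (1 - l) * (Ig / B) powr l \<le> Ih / k" using le by linarith
    moreover have "(If / A) powr (1 - l) * (Ig / B) powr l = If powr (1 - l) * Ig powr l / k"
      using A B If Ig by (simp add: powr_divide k_def)
    ultimately have "If powr (1 - l) * Ig powr l \<le> Ih"
      using k by (simp add: divide_le_cancel)
    then show ?thesis by (simp add: If_def Ig_def Ih_def)
  qed
qed

section \<open>Prekopa's theorem for marginals\<close>

definition comb_Rn :: "nat \<Rightarrow> real \<Rightarrow> (nat \<Rightarrow> real) \<Rightarrow> real \<Rightarrow> (nat \<Rightarrow> real) \<Rightarrow> (nat \<Rightarrow> real)" where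
  "comb_Rn n a x b y = (\<lambda>i\<in>{..<n}. a * x i + b * y i)"

text \<open>
  The last clause is joint log-concavity in the parameter and the point. The parameter ranges over a
  vector space of its own, so that integrating out one coordinate leaves an object of the same kind.
  Bounded values and bounded support make all the integrals finite, hence \<^const>\<open>enn2real\<close> harmless.
\<close>

definition log_concave_family :: "nat \<Rightarrow> ('p::real_vector \<Rightarrow> (nat \<Rightarrow> real) \<Rightarrow> real) \<Rightarrow> bool" where
  "log_concave_family n F \<longleftrightarrow>
     (\<forall>p. F p \<in> borel_measurable (lborel_Rn n)) \<and>
     (\<forall>p. \<forall>x\<in>Rn n. 0 \<le> F p x) \<and>
     (\<forall>p. \<exists>M. \<forall>x\<in>Rn n. F p x \<le> M) \<and>
     (\<forall>p. \<exists>R. \<forall>x\<in>Rn n. F p x \<noteq> 0 \<longrightarrow> (\<forall>i<n. \<bar>x i\<bar> \<le> R)) \<and>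
     (\<forall>l p q. \<forall>x\<in>Rn n. \<forall>y\<in>Rn n. 0 < l \<longrightarrow> l < 1 \<longrightarrow>
        F p x powr (1 - l) * F q y powr l
          \<le> F ((1 - l) *\<^sub>R p + l *\<^sub>R q) (comb_Rn n (1 - l) x l y))"

lemma upd_in_Rn: "x \<in> Rn n \<Longrightarrow> x(n := u) \<in> Rn (Suc n)"
  by (auto simp: PiE_iff extensional_def)

lemma comb_Rn_upd:
  "comb_Rn (Suc n) a (x(n := u)) b (y(n := v)) = (comb_Rn n a x b y)(n := a * u + b * v)"
  by (auto simp: comb_Rn_def fun_eq_iff less_Suc_eq)

lemma measurable_upd_Rn:
  assumes "f \<in> borel_measurable (lborel_Rn (Suc n))"
  shows "(\<lambda>(x, u). f (x(n := u))) \<in> borel_measurable (lborel_Rn n \<Otimes>\<^sub>M lborel)"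
proof -
  have "(\<lambda>(x, u). x(n := u)) \<in> lborel_Rn n \<Otimes>\<^sub>M lborel \<rightarrow>\<^sub>M lborel_Rn (Suc n)"
    using measurable_add_dim[of n "{..<n}" "\<lambda>_. lborel::real measure"] by (simp add: lessThan_Suc)
  from measurable_compose[OF this assms] show ?thesis by (simp add: split_beta')
qed

lemma measurable_upd_Rn_slice:
  assumes "f \<in> borel_measurable (lborel_Rn (Suc n))" "x \<in> Rn n"
  shows "(\<lambda>u. f (x(n := u))) \<in> borel_measurable borel"
proof -
  have "x \<in> space (lborel_Rn n)" using assms(2) by (simp add: space_PiM)
  then show ?thesis
    using measurable_compose[OF measurable_Pair1' measurable_upd_Rn[OF assms(1)]] by simp
qed

lemma nn_integral_Rn_Suc:
  fixes f :: "(nat \<Rightarrow> real) \<Rightarrow> ennreal"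
  assumes "f \<in> borel_measurable (lborel_Rn (Suc n))"
  shows "(\<integral>\<^sup>+x. f x \<partial>lborel_Rn (Suc n)) = (\<integral>\<^sup>+x. \<integral>\<^sup>+u. f (x(n := u)) \<partial>lborel \<partial>lborel_Rn n)"
proof -
  interpret product_sigma_finite "\<lambda>_. lborel :: real measure" by standard
  show ?thesis
    using product_nn_integral_insert[of "{..<n}" n f] assms by (simp add: lessThan_Suc)
qed

lemma log_concave_family_slice_finite:
  assumes F: "log_concave_family (Suc n) F" and x: "x \<in> Rn n"
  shows "(\<integral>\<^sup>+u. F p (x(n := u)) \<partial>lborel) < \<infinity>"
    and "\<exists>C. \<forall>x\<in>Rn n. enn2real (\<integral>\<^sup>+u. F p (x(n := u)) \<partial>lborel) \<le> C"
proof -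
  obtain M R where MR: "\<And>x. x \<in> Rn (Suc n) \<Longrightarrow> F p x \<le> M"
      "\<And>x i. x \<in> Rn (Suc n) \<Longrightarrow> F p x \<noteq> 0 \<Longrightarrow> i < Suc n \<Longrightarrow> \<bar>x i\<bar> \<le> R"
    using F unfolding log_concave_family_def by meson
  have le: "(\<integral>\<^sup>+u. F p (z(n := u)) \<partial>lborel) \<le> ennreal (max 0 M) * ennreal (max 0 (2 * R))"
    if z: "z \<in> Rn n" for z
  proof -
    have "(\<integral>\<^sup>+u. F p (z(n := u)) \<partial>lborel) \<le> (\<integral>\<^sup>+u. ennreal (max 0 M) * indicator {-R..R} u \<partial>lborel)"
    proof (intro nn_integral_mono)
      fix u
      show "ennreal (F p (z(n := u))) \<le> ennreal (max 0 M) * indicator {-R..R} u"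
        using MR(1)[OF upd_in_Rn[OF z, of u]] MR(2)[OF upd_in_Rn[OF z, of u], of n]
        by (cases "F p (z(n := u)) = 0") (auto simp: abs_le_iff intro!: ennreal_leI)
    qed
    also have "\<dots> = ennreal (max 0 M) * ennreal (max 0 (2 * R))"
      by (cases "0 \<le> R") (auto simp: nn_integral_cmult)
    finally show ?thesis .
  qed
  have "ennreal (max 0 M) * ennreal (max 0 (2 * R)) < \<infinity>"
    by (simp add: ennreal_mult_less_top)
  then show "(\<integral>\<^sup>+u. F p (x(n := u)) \<partial>lborel) < \<infinity>" using le[OF x] by (rule le_less_trans[rotated])
  show "\<exists>C. \<forall>x\<in>Rn n. enn2real (\<integral>\<^sup>+u. F p (x(n := u)) \<partial>lborel) \<le> C"
  proof (intro exI ballI)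
    fix z assume "z \<in> Rn n"
    from le[OF this] show "enn2real (\<integral>\<^sup>+u. F p (z(n := u)) \<partial>lborel)
        \<le> max 0 M * max 0 (2 * R)"
      by (intro enn2real_leI) (auto simp: ennreal_mult)
  qed
qed

text \<open>
  This is the inductive step. For fixed \<open>(p, x)\<close>, \<open>(q, y)\<close> and their combination, the three functions of
  the last coordinate satisfy the hypotheses of the one-dimensional inequality; their level sets
  are convex because each of them is itself log-concave.
\<close>

lemma log_concave_family_marginal:
  fixes F :: "'p::real_vector \<Rightarrow> (nat \<Rightarrow> real) \<Rightarrow> real"
  assumes F: "log_concave_family (Suc n) F"
  shows "log_concave_family n (\<lambda>p x. enn2real (\<integral>\<^sup>+u. F p (x(n := u)) \<partial>lborel))"
proof -
  have meas[measurable]: "F p \<in> borel_measurable (lborel_Rn (Suc n))" for p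
    using F by (simp add: log_concave_family_def)
  have nonneg: "0 \<le> F p x" if "x \<in> Rn (Suc n)" for p x
    using F that by (simp add: log_concave_family_def)
  have lc: "F p x powr (1 - l) * F q y powr l
          \<le> F ((1 - l) *\<^sub>R p + l *\<^sub>R q) (comb_Rn (Suc n) (1 - l) x l y)"
    if "x \<in> Rn (Suc n)" "y \<in> Rn (Suc n)" "0 < l" "l < 1" for x y l p q
    using F that by (simp add: log_concave_family_def)
  have slice_conv: "convex {u. c < F p (x(n := u))}" if c: "0 < c" and x: "x \<in> Rn n" for c p x
    unfolding convex_alt
  proof (intro ballI allI impI)
    fix u v l :: real assume uv: "u \<in> {u. c < F p (x(n := u))}" "v \<in> {u. c < F p (x(n := u))}"
      and l: "0 \<le> l \<and> l \<le> 1"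
    show "(1 - l) *\<^sub>R u + l *\<^sub>R v \<in> {u. c < F p (x(n := u))}"
    proof (cases "l = 0 \<or> l = 1")
      case True
      then show ?thesis using uv by auto
    next
      case False
      then have l: "0 < l" "l < 1" using l by auto
      have "comb_Rn n (1 - l) x l x = x"
        using x by (auto simp: comb_Rn_def PiE_iff extensional_def fun_eq_iff algebra_simps)
      then have "F p (x(n := u)) powr (1 - l) * F p (x(n := v)) powr l
          \<le> F p (x(n := (1 - l) * u + l * v))"
        using lc[OF upd_in_Rn[OF x, of u] upd_in_Rn[OF x, of v] l, of p p]
        by (simp add: comb_Rn_upd scaleR_left_distrib[symmetric])
      moreover have "c powr (1 - l) * c powr l < F p (x(n := u)) powr (1 - l) * F p (x(n := v)) powr l"
        using uv c l by (intro mult_strict_mono powr_less_mono2) auto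
      moreover have "c powr (1 - l) * c powr l = c" using c by (simp add: powr_add[symmetric])
      ultimately show ?thesis by auto
    qed
  qed
  show ?thesis
    unfolding log_concave_family_def
  proof (intro conjI allI ballI impI)
    fix p
    have "(\<lambda>(x, u). ennreal (F p (x(n := u)))) \<in> borel_measurable (lborel_Rn n \<Otimes>\<^sub>M lborel)"
      using measurable_compose[OF measurable_upd_Rn[OF meas] measurable_ennreal]
      by (simp add: split_beta')
    then have "(\<lambda>x. \<integral>\<^sup>+u. F p (x(n := u)) \<partial>lborel) \<in> borel_measurable (lborel_Rn n)"
      by (rule lborel.borel_measurable_nn_integral)
    then show "(\<lambda>x. enn2real (\<integral>\<^sup>+u. F p (x(n := u)) \<partial>lborel)) \<in> borel_measurable (lborel_Rn n)"
      by measurable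
    show "\<exists>M. \<forall>x\<in>Rn n. enn2real (\<integral>\<^sup>+u. F p (x(n := u)) \<partial>lborel) \<le> M"
      using log_concave_family_slice_finite(2)[OF F, of "\<lambda>i\<in>{..<n}. 0"] by simp
    obtain R where R: "\<And>x i. x \<in> Rn (Suc n) \<Longrightarrow> F p x \<noteq> 0 \<Longrightarrow> i < Suc n \<Longrightarrow> \<bar>x i\<bar> \<le> R"
      using F unfolding log_concave_family_def by meson
    show "\<exists>R. \<forall>x\<in>Rn n. enn2real (\<integral>\<^sup>+u. F p (x(n := u)) \<partial>lborel) \<noteq> 0 \<longrightarrow> (\<forall>i<n. \<bar>x i\<bar> \<le> R)"
    proof (intro exI[of _ R] ballI impI allI)
      fix x i assume x: "x \<in> Rn n" and ne: "enn2real (\<integral>\<^sup>+u. F p (x(n := u)) \<partial>lborel) \<noteq> 0" and i: "i < n"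
      obtain u where u: "F p (x(n := u)) \<noteq> 0"
      proof (rule ccontr)
        assume "\<not> thesis"
        then have "F p (x(n := u)) = 0" for u using that by blast
        then show False using ne by simp
      qed
      then show "\<bar>x i\<bar> \<le> R" using R[OF upd_in_Rn[OF x] u, of i] i by simp
    qed
  next
    fix l :: real and p q :: 'p and x y :: "nat \<Rightarrow> real"
    assume x: "x \<in> Rn n" and y: "y \<in> Rn n" and l: "0 < l" "l < 1"
    define z where "z = comb_Rn n (1 - l) x l y"
    define r where "r = (1 - l) *\<^sub>R p + l *\<^sub>R q"
    have z: "z \<in> Rn n" by (simp add: z_def comb_Rn_def)
    obtain M R where MR: "\<And>x. x \<in> Rn (Suc n) \<Longrightarrow> F p x \<le> M"
      "\<And>x i. x \<in> Rn (Suc n) \<Longrightarrow> F p x \<noteq> 0 \<Longrightarrow> i < Suc n \<Longrightarrow> \<bar>x i\<bar> \<le> R"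
      using F unfolding log_concave_family_def by meson
    obtain M' R' where MR': "\<And>x. x \<in> Rn (Suc n) \<Longrightarrow> F q x \<le> M'"
      "\<And>x i. x \<in> Rn (Suc n) \<Longrightarrow> F q x \<noteq> 0 \<Longrightarrow> i < Suc n \<Longrightarrow> \<bar>x i\<bar> \<le> R'"
      using F unfolding log_concave_family_def by meson
    have "enn2real (\<integral>\<^sup>+u. F p (x(n := u)) \<partial>lborel) powr (1 - l)
        * enn2real (\<integral>\<^sup>+u. F q (y(n := u)) \<partial>lborel) powr l
        \<le> enn2real (\<integral>\<^sup>+u. F r (z(n := u)) \<partial>lborel)"
    proof (rule prekopa_leindler_real)
      show "0 < l" "l < 1" by fact+
      show "(\<lambda>u. F p (x(n := u))) \<in> borel_measurable borel"
        "(\<lambda>u. F q (y(n := u))) \<in> borel_measurable borel"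
        "(\<lambda>u. F r (z(n := u))) \<in> borel_measurable borel"
        using measurable_upd_Rn_slice[OF meas] x y z by blast+
      show "0 \<le> F p (x(n := u))" "0 \<le> F q (y(n := u))" "0 \<le> F r (z(n := u))" for u
        using nonneg upd_in_Rn x y z by blast+
      show "F p (x(n := u)) \<le> M" "F q (y(n := u)) \<le> M'" for u
        using MR(1) MR'(1) upd_in_Rn x y by blast+
      show "F p (x(n := u)) \<noteq> 0 \<Longrightarrow> \<bar>u\<bar> \<le> R" for u
        using MR(2)[OF upd_in_Rn[OF x], of u n] by simp
      show "F q (y(n := u)) \<noteq> 0 \<Longrightarrow> \<bar>u\<bar> \<le> R'" for u
        using MR'(2)[OF upd_in_Rn[OF y], of u n] by simp
      show "0 < c \<Longrightarrow> convex {u. c < F p (x(n := u))}" "0 < c \<Longrightarrow> convex {u. c < F q (y(n := u))}" for c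
        using slice_conv x y by blast+
      show "(\<integral>\<^sup>+u. F r (z(n := u)) \<partial>lborel) < \<infinity>"
        by (rule log_concave_family_slice_finite[OF F z])
      show "F p (x(n := u)) powr (1 - l) * F q (y(n := v)) powr l
          \<le> F r (z(n := (1 - l) * u + l * v))" for u v
        using lc[OF upd_in_Rn[OF x, of u] upd_in_Rn[OF y, of v] l, of p q]
        by (simp add: comb_Rn_upd r_def z_def)
    qed
    then show "enn2real (\<integral>\<^sup>+u. F p (x(n := u)) \<partial>lborel) powr (1 - l)
        * enn2real (\<integral>\<^sup>+u. F q (y(n := u)) \<partial>lborel) powr l
        \<le> enn2real (\<integral>\<^sup>+u. F ((1 - l) *\<^sub>R p + l *\<^sub>R q) ((comb_Rn n (1 - l) x l y)(n := u)) \<partial>lborel)"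
      by (simp add: r_def z_def)
  qed simp
qed

lemma prekopa:
  fixes F :: "'p::real_vector \<Rightarrow> (nat \<Rightarrow> real) \<Rightarrow> real"
  assumes "log_concave_family n F" "0 < l" "l < 1"
  shows "enn2real (\<integral>\<^sup>+x. F p x \<partial>lborel_Rn n) powr (1 - l) * enn2real (\<integral>\<^sup>+x. F q x \<partial>lborel_Rn n) powr l
    \<le> enn2real (\<integral>\<^sup>+x. F ((1 - l) *\<^sub>R p + l *\<^sub>R q) x \<partial>lborel_Rn n)"
  using assms
proof (induction n arbitrary: F)
  case 0
  interpret product_sigma_finite "\<lambda>_. lborel :: real measure" by standard
  have F: "0 \<le> F r (\<lambda>_. undefined)" for r using 0 by (auto simp: log_concave_family_def)
  have "F p (\<lambda>_. undefined) powr (1 - l) * F q (\<lambda>_. undefined) powr l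
      \<le> F ((1 - l) *\<^sub>R p + l *\<^sub>R q) (comb_Rn 0 (1 - l) (\<lambda>_. undefined) l (\<lambda>_. undefined))"
    using 0 unfolding log_concave_family_def by auto
  moreover have "comb_Rn 0 (1 - l) (\<lambda>_. undefined) l (\<lambda>_. undefined) = (\<lambda>_. undefined)"
    by (simp add: comb_Rn_def fun_eq_iff)
  ultimately show ?case using F by (simp add: nn_integral_empty)
next
  case (Suc n)
  have "(\<integral>\<^sup>+x. F r x \<partial>lborel_Rn (Suc n))
      = (\<integral>\<^sup>+x. ennreal (enn2real (\<integral>\<^sup>+u. F r (x(n := u)) \<partial>lborel)) \<partial>lborel_Rn n)" for r
  proof -
    have [measurable]: "F r \<in> borel_measurable (lborel_Rn (Suc n))"
      using Suc.prems(1) by (simp add: log_concave_family_def)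
    have "(\<integral>\<^sup>+x. F r x \<partial>lborel_Rn (Suc n)) = (\<integral>\<^sup>+x. \<integral>\<^sup>+u. F r (x(n := u)) \<partial>lborel \<partial>lborel_Rn n)"
      by (intro nn_integral_Rn_Suc) measurable
    also have "\<dots> = (\<integral>\<^sup>+x. ennreal (enn2real (\<integral>\<^sup>+u. F r (x(n := u)) \<partial>lborel)) \<partial>lborel_Rn n)"
    proof (intro nn_integral_cong)
      fix x assume "x \<in> space (lborel_Rn n)"
      then have "x \<in> Rn n" by (simp add: space_PiM)
      from log_concave_family_slice_finite(1)[OF Suc.prems(1) this, of r]
      show "(\<integral>\<^sup>+u. F r (x(n := u)) \<partial>lborel) = ennreal (enn2real (\<integral>\<^sup>+u. F r (x(n := u)) \<partial>lborel))"
        unfolding infinity_ennreal_def by (rule ennreal_enn2real[symmetric])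
    qed
    finally show ?thesis .
  qed
  then show ?case
    using Suc.IH[OF log_concave_family_marginal[OF Suc.prems(1)] Suc.prems(2,3)] by (simp only:)
qed

section \<open>Scaling, measurability and boundedness in coordinates\<close>

lemma nn_integral_Rn_scale:
  fixes f :: "(nat \<Rightarrow> real) \<Rightarrow> ennreal"
  assumes c: "0 < c" and "f \<in> borel_measurable (lborel_Rn n)"
  shows "(\<integral>\<^sup>+x. f x \<partial>lborel_Rn n) = ennreal (c ^ n) * (\<integral>\<^sup>+x. f (\<lambda>i\<in>{..<n}. c * x i) \<partial>lborel_Rn n)"
  using assms(2)
proof (induction n arbitrary: f)
  case 0
  interpret product_sigma_finite "\<lambda>_. lborel :: real measure" by standard
  show ?case by (simp add: nn_integral_empty restrict_def del: nn_integral_const)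
next
  case (Suc n)
  note [measurable] = Suc.prems
  define g where "g x = (\<integral>\<^sup>+u. f (x(n := u)) \<partial>lborel)" for x
  have g: "g \<in> borel_measurable (lborel_Rn n)"
    unfolding g_def by (rule lborel.borel_measurable_nn_integral) (rule measurable_upd_Rn[OF Suc.prems])
  have sc: "(\<lambda>x. \<lambda>i\<in>{..<m}. c * x i) \<in> lborel_Rn m \<rightarrow>\<^sub>M lborel_Rn m" for m
    by measurable
  have "(\<integral>\<^sup>+x. f x \<partial>lborel_Rn (Suc n)) = (\<integral>\<^sup>+x. g x \<partial>lborel_Rn n)"
    unfolding g_def by (rule nn_integral_Rn_Suc) fact
  also have "\<dots> = ennreal (c ^ n) * (\<integral>\<^sup>+x. g (\<lambda>i\<in>{..<n}. c * x i) \<partial>lborel_Rn n)"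
    by (rule Suc.IH) fact
  also have "(\<integral>\<^sup>+x. g (\<lambda>i\<in>{..<n}. c * x i) \<partial>lborel_Rn n)
      = (\<integral>\<^sup>+x. ennreal c * (\<integral>\<^sup>+u. f (\<lambda>i\<in>{..<Suc n}. c * (x(n := u)) i) \<partial>lborel) \<partial>lborel_Rn n)"
  proof (intro nn_integral_cong)
    fix x assume "x \<in> space (lborel_Rn n)"
    define y where "y = (\<lambda>i\<in>{..<n}. c * x i)"
    have y: "y \<in> Rn n" by (simp add: y_def)
    have "(\<lambda>i\<in>{..<Suc n}. c * (x(n := u)) i) = y(n := 0 + c * u)" for u
      by (auto simp: y_def fun_eq_iff less_Suc_eq)
    moreover have "g y = ennreal c * (\<integral>\<^sup>+u. f (y(n := 0 + c * u)) \<partial>lborel)"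
      using nn_integral_real_affine[OF measurable_upd_Rn_slice[OF Suc.prems y], of c 0] c
      by (simp only: g_def abs_of_pos)
    ultimately show "g (\<lambda>i\<in>{..<n}. c * x i)
        = ennreal c * (\<integral>\<^sup>+u. f (\<lambda>i\<in>{..<Suc n}. c * (x(n := u)) i) \<partial>lborel)"
      by (simp only: y_def)
  qed
  also have "\<dots> = ennreal c * (\<integral>\<^sup>+x. \<integral>\<^sup>+u. f (\<lambda>i\<in>{..<Suc n}. c * (x(n := u)) i) \<partial>lborel \<partial>lborel_Rn n)"
    by (intro nn_integral_cmult lborel.borel_measurable_nn_integral measurable_upd_Rn
        measurable_compose[OF sc Suc.prems])
  also have "(\<integral>\<^sup>+x. \<integral>\<^sup>+u. f (\<lambda>i\<in>{..<Suc n}. c * (x(n := u)) i) \<partial>lborel \<partial>lborel_Rn n)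
      = (\<integral>\<^sup>+x. f (\<lambda>i\<in>{..<Suc n}. c * x i) \<partial>lborel_Rn (Suc n))"
    by (intro nn_integral_Rn_Suc[symmetric] measurable_compose[OF sc Suc.prems])
  finally have "(\<integral>\<^sup>+x. f x \<partial>lborel_Rn (Suc n))
      = ennreal (c ^ n) * (ennreal c * (\<integral>\<^sup>+x. f (\<lambda>i\<in>{..<Suc n}. c * x i) \<partial>lborel_Rn (Suc n)))" .
  moreover have "ennreal (c ^ Suc n) = ennreal (c ^ n) * ennreal c"
    using c by (simp add: ennreal_mult[symmetric] mult.commute)
  ultimately show ?case by (simp only: mult.assoc)
qed

lemma space_lborel_Rn: "space (lborel_Rn n) = Rn n"
  by (simp add: space_PiM)

lemma openin_Rn_basis:
  assumes "openin (Rn_topology n) U" "x \<in> U"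
  obtains V where "\<And>i. i < n \<Longrightarrow> open (V i)" "x \<in> Pi\<^sub>E {..<n} V" "Pi\<^sub>E {..<n} V \<subseteq> U"
proof -
  from assms obtain V where "\<forall>i\<in>{..<n}. openin euclideanreal (V i)" "x \<in> Pi\<^sub>E {..<n} V" "Pi\<^sub>E {..<n} V \<subseteq> U"
    unfolding openin_product_topology_alt by meson
  then show ?thesis using that[of V] by simp
qed

text \<open>
  The product topology has a countable base of boxes with rational corners, and boxes generate the
  product of the Borel algebras.
\<close>

lemma openin_Rn_measurable:
  assumes U: "openin (Rn_topology n) U"
  shows "U \<in> sets (lborel_Rn n)"
proof -
  define box where "box = (\<lambda>(a :: nat \<Rightarrow> real, b :: nat \<Rightarrow> real). \<Pi>\<^sub>E i\<in>{..<n}. {a i<..<b i})"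
  define D where "D = {ab \<in> ({..<n} \<rightarrow>\<^sub>E \<rat>) \<times> ({..<n} \<rightarrow>\<^sub>E \<rat>). box ab \<subseteq> U}"
  have "countable (({..<n} \<rightarrow>\<^sub>E (\<rat> :: real set)) \<times> ({..<n} \<rightarrow>\<^sub>E (\<rat> :: real set)))"
    by (intro countable_SIGMA countable_PiE) (auto simp: countable_rat)
  then have D: "countable D" unfolding D_def by (rule countable_subset[rotated]) auto
  have box: "box ab \<in> sets (lborel_Rn n)" for ab
    unfolding box_def by (auto simp: split_beta' intro!: sets_PiM_I_finite)
  have "U = (\<Union>ab\<in>D. box ab)"
  proof
    show "(\<Union>ab\<in>D. box ab) \<subseteq> U" by (auto simp: D_def)
    show "U \<subseteq> (\<Union>ab\<in>D. box ab)"
    proof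
      fix x assume "x \<in> U"
      obtain V where V: "\<And>i. i < n \<Longrightarrow> open (V i)" "x \<in> Pi\<^sub>E {..<n} V" "Pi\<^sub>E {..<n} V \<subseteq> U"
        by (rule openin_Rn_basis[OF U \<open>x \<in> U\<close>]) blast
      have "\<exists>a b. a \<in> \<rat> \<and> b \<in> \<rat> \<and> a < x i \<and> x i < b \<and> {a<..<b} \<subseteq> V i" if i: "i < n" for i
      proof -
        have "x i \<in> V i" using V(2) i by auto
        then obtain e where e: "e > 0" "\<And>y. dist y (x i) < e \<Longrightarrow> y \<in> V i"
          using V(1)[OF i] unfolding open_dist by blast
        obtain a where a: "a \<in> \<rat>" "x i - e < a" "a < x i"
          using Rats_dense_in_real[of "x i - e" "x i"] e(1) by auto
        obtain b where b: "b \<in> \<rat>" "x i < b" "b < x i + e"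
          using Rats_dense_in_real[of "x i" "x i + e"] e(1) by auto
        have "{a<..<b} \<subseteq> V i" using a b by (auto simp: dist_real_def intro!: e(2))
        then show ?thesis using a b by blast
      qed
      then obtain a b where ab: "\<And>i. i < n \<Longrightarrow> a i \<in> \<rat> \<and> b i \<in> \<rat> \<and> a i < x i \<and> x i < b i \<and> {a i<..<b i} \<subseteq> V i"
        by metis
      define a' b' where "a' = restrict a {..<n}" and "b' = restrict b {..<n}"
      have "box (a', b') \<subseteq> Pi\<^sub>E {..<n} V"
        unfolding box_def split_conv using ab by (intro PiE_mono) (auto simp: a'_def b'_def)
      moreover have "x \<in> box (a', b')"
        using V(2) ab by (auto simp: box_def a'_def b'_def PiE_iff)
      moreover have "a' \<in> {..<n} \<rightarrow>\<^sub>E \<rat>" "b' \<in> {..<n} \<rightarrow>\<^sub>E \<rat>"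
        using ab by (auto simp: a'_def b'_def)
      ultimately show "x \<in> (\<Union>ab\<in>D. box ab)"
        using V(3) by (intro UN_I[of "(a', b')"]) (auto simp: D_def)
    qed
  qed
  moreover have "(\<Union>ab\<in>D. box ab) \<in> sets (lborel_Rn n)"
    using D box by (rule sets.countable_UN'')
  ultimately show ?thesis by (simp only:)
qed

lemma compactin_Rn_measurable:
  assumes "compactin (Rn_topology n) K"
  shows "K \<in> sets (lborel_Rn n)"
proof -
  have "closedin (Rn_topology n) K"
    using assms by (intro compactin_imp_closedin) (auto simp: Hausdorff_space_product_topology)
  then have K: "K \<subseteq> Rn n" "openin (Rn_topology n) (Rn n - K)"
    by (auto simp: closedin_def)
  have "Rn n - (Rn n - K) \<in> sets (lborel_Rn n)"
    using openin_Rn_measurable[OF K(2)] sets.compl_sets[of "Rn n - K" "lborel_Rn n"]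
    by (simp only: space_lborel_Rn)
  moreover have "Rn n - (Rn n - K) = K" using K(1) by blast
  ultimately show ?thesis by (simp only:)
qed

lemma compactin_Rn_bounded:
  assumes "compactin (Rn_topology n) K"
  obtains R where "0 < R" "\<And>x i. x \<in> K \<Longrightarrow> i < n \<Longrightarrow> \<bar>x i\<bar> \<le> R"
proof -
  have "\<exists>R. \<forall>x\<in>K. \<bar>x i\<bar> \<le> R" if i: "i < n" for i
  proof -
    have "compactin euclideanreal ((\<lambda>x. x i) ` K)"
      using assms i by (intro image_compactin) (auto intro: continuous_map_product_projection)
    then have "bounded ((\<lambda>x. x i) ` K)" by (simp add: compact_imp_bounded)
    then show ?thesis by (simp add: bounded_iff)
  qed
  then obtain R where R: "\<And>i x. i < n \<Longrightarrow> x \<in> K \<Longrightarrow> \<bar>x i\<bar> \<le> R i" by metis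
  have "\<bar>x i\<bar> \<le> 1 + (\<Sum>j<n. \<bar>R j\<bar>)" if "x \<in> K" "i < n" for x i
  proof -
    have "\<bar>x i\<bar> \<le> \<bar>R i\<bar>" using R that by fastforce
    also have "\<dots> \<le> (\<Sum>j<n. \<bar>R j\<bar>)" using that by (intro member_le_sum) auto
    finally show ?thesis by simp
  qed
  moreover have "0 < 1 + (\<Sum>j<n. \<bar>R j\<bar>)" by (intro add_pos_nonneg sum_nonneg) auto
  ultimately show ?thesis using that by blast
qed

lemma emeasure_cube_Rn:
  assumes "0 < r"
  shows "emeasure (lborel_Rn n) (\<Pi>\<^sub>E i\<in>{..<n}. {c i - r<..<c i + r}) = ennreal ((2 * r) ^ n)"
proof -
  interpret product_sigma_finite "\<lambda>_. lborel :: real measure" by standard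
  show ?thesis using assms by (subst emeasure_PiM) (auto simp: ennreal_power)
qed

lemma convex_body_subset_Rn: "convex_body n K \<Longrightarrow> K \<subseteq> Rn n"
  by (auto simp: convex_body_def compactin_def)

lemma convex_body_sets: "convex_body n K \<Longrightarrow> K \<in> sets (lborel_Rn n)"
  by (simp add: convex_body_def compactin_Rn_measurable)

lemma convex_body_emeasure_finite:
  assumes "convex_body n K"
  shows "emeasure (lborel_Rn n) K < \<infinity>"
proof -
  obtain R where R: "0 < R" "\<And>x i. x \<in> K \<Longrightarrow> i < n \<Longrightarrow> \<bar>x i\<bar> \<le> R"
    using compactin_Rn_bounded assms unfolding convex_body_def by metis
  have "K \<subseteq> (\<Pi>\<^sub>E i\<in>{..<n}. {0 - (R + 1)<..<0 + (R + 1)})"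
  proof
    fix x assume x: "x \<in> K"
    have "x i \<in> {0 - (R + 1)<..<0 + (R + 1)}" if "i < n" for i using R(2)[OF x that] by (auto simp: abs_le_iff)
    then show "x \<in> (\<Pi>\<^sub>E i\<in>{..<n}. {0 - (R + 1)<..<0 + (R + 1)})"
      using convex_body_subset_Rn[OF assms] x by (auto simp: PiE_iff)
  qed
  then have "emeasure (lborel_Rn n) K \<le> emeasure (lborel_Rn n) (\<Pi>\<^sub>E i\<in>{..<n}. {0 - (R + 1)<..<0 + (R + 1)})"
    by (intro emeasure_mono) (auto intro!: sets_PiM_I_finite)
  also have "\<dots> = ennreal ((2 * (R + 1)) ^ n)"
    using emeasure_cube_Rn[of "R + 1" n "\<lambda>_. 0"] R(1) by simp
  also have "\<dots> < \<infinity>" by simp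
  finally show ?thesis .
qed

lemma interior_of_Rn: "x \<in> Rn_topology n interior_of K \<Longrightarrow> x \<in> Rn n"
  using interior_of_subset_topspace[of "Rn_topology n" K]
  by (simp only: topspace_product_topology topspace_euclidean subset_iff)

lemma interior_of_Rn_cube:
  assumes "x \<in> Rn_topology n interior_of K"
  obtains r where "0 < r" "(\<Pi>\<^sub>E i\<in>{..<n}. {x i - r<..<x i + r}) \<subseteq> K"
proof -
  from assms obtain T where T: "openin (Rn_topology n) T" "x \<in> T" "T \<subseteq> K"
    by (auto simp: interior_of_def)
  obtain V where V: "\<And>i. i < n \<Longrightarrow> open (V i)" "x \<in> Pi\<^sub>E {..<n} V" "Pi\<^sub>E {..<n} V \<subseteq> T"
    by (rule openin_Rn_basis[OF T(1,2)]) blast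
  have "\<exists>e>0. \<forall>y. dist y (x i) < e \<longrightarrow> y \<in> V i" if i: "i < n" for i
    using V(1)[OF i] V(2) i unfolding open_dist by auto
  then obtain e where e: "\<And>i. i < n \<Longrightarrow> 0 < e i" "\<And>i y. i < n \<Longrightarrow> dist y (x i) < e i \<Longrightarrow> y \<in> V i"
    by metis
  define r where "r = Min (insert 1 (e ` {..<n}))"
  have r: "0 < r" using e(1) by (auto simp: r_def)
  have re: "r \<le> e i" if "i < n" for i using that by (auto simp: r_def intro!: Min_le)
  have "(\<Pi>\<^sub>E i\<in>{..<n}. {x i - r<..<x i + r}) \<subseteq> Pi\<^sub>E {..<n} V"
  proof (intro PiE_mono subsetI)
    fix i y assume i: "i \<in> {..<n}" and y: "y \<in> {x i - r<..<x i + r}"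
    then show "y \<in> V i" using re[of i] by (intro e(2)) (auto simp: dist_real_def abs_less_iff)
  qed
  then have "(\<Pi>\<^sub>E i\<in>{..<n}. {x i - r<..<x i + r}) \<subseteq> K" using V(3) T(3) by (rule order_trans[OF _ order_trans])
  then show ?thesis using r by (intro that)
qed

section \<open>The Brunn--Minkowski inequality for caps\<close>

definition cap :: "nat \<Rightarrow> (nat \<Rightarrow> real) set \<Rightarrow> (nat \<Rightarrow> real) \<Rightarrow> real \<Rightarrow> (nat \<Rightarrow> real) set" where
  "cap n K \<theta> u = {y \<in> K. u \<le> inner_Rn n \<theta> y}"

definition cap_volume :: "nat \<Rightarrow> (nat \<Rightarrow> real) set \<Rightarrow> (nat \<Rightarrow> real) \<Rightarrow> real \<Rightarrow> real" where
  "cap_volume n K \<theta> u = measure (lborel_Rn n) (cap n K \<theta> u)"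

lemma measurable_inner_Rn [measurable]: "inner_Rn n \<theta> \<in> borel_measurable (lborel_Rn n)"
  unfolding inner_Rn_def by measurable

lemma cap_sets: "convex_body n K \<Longrightarrow> cap n K \<theta> u \<in> sets (lborel_Rn n)"
proof -
  assume K: "convex_body n K"
  note [measurable] = convex_body_sets[OF K]
  have "cap n K \<theta> u = {y \<in> space (lborel_Rn n). y \<in> K \<and> u \<le> inner_Rn n \<theta> y}"
    using convex_body_subset_Rn[OF K] unfolding cap_def space_lborel_Rn by blast
  also have "\<dots> \<in> sets (lborel_Rn n)" by measurable
  finally show ?thesis .
qed

lemma emeasure_cap:
  assumes "convex_body n K"
  shows "emeasure (lborel_Rn n) (cap n K \<theta> u) = ennreal (cap_volume n K \<theta> u)"
proof -
  have "emeasure (lborel_Rn n) (cap n K \<theta> u) \<le> emeasure (lborel_Rn n) K"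
    using convex_body_sets[OF assms] by (intro emeasure_mono) (auto simp: cap_def)
  also have "\<dots> < \<infinity>" by (rule convex_body_emeasure_finite) fact
  finally show ?thesis unfolding cap_volume_def by (intro emeasure_eq_ennreal_measure) auto
qed

lemma cap_volume_antimono:
  assumes "convex_body n K" "u \<le> v"
  shows "cap_volume n K \<theta> v \<le> cap_volume n K \<theta> u"
proof -
  have "emeasure (lborel_Rn n) (cap n K \<theta> v) \<le> emeasure (lborel_Rn n) (cap n K \<theta> u)"
    using cap_sets[OF assms(1)] assms(2) by (intro emeasure_mono) (auto simp: cap_def)
  then show ?thesis
    by (simp add: emeasure_cap[OF assms(1)] ennreal_le_iff cap_volume_def)
qed

text \<open>
  The set \<open>{(v, w, y). v > 0, y \<in> v K, \<langle>\<theta>, y\<rangle> \<ge> w}\<close> is convex, and its fibre over \<open>(v, w)\<close> is the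
  dilate by \<open>v\<close> of the cap of \<open>K\<close> at height \<open>w / v\<close>. Keeping the dilation factor as a parameter turns
  the multiplicative inequality of Prekopa into the \<open>n\<close>-th root inequality of Brunn--Minkowski.
\<close>

definition dilated_cap_indicator :: "nat \<Rightarrow> (nat \<Rightarrow> real) set \<Rightarrow> (nat \<Rightarrow> real) \<Rightarrow> real \<times> real \<Rightarrow> (nat \<Rightarrow> real) \<Rightarrow> real" where
  "dilated_cap_indicator n K \<theta> = (\<lambda>(v, w) y.
     if 0 < v \<and> (\<lambda>i\<in>{..<n}. y i / v) \<in> K \<and> w \<le> inner_Rn n \<theta> y then 1 else 0)"

lemma inner_Rn_comb: "inner_Rn n \<theta> (comb_Rn n a x b y) = a * inner_Rn n \<theta> x + b * inner_Rn n \<theta> y"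
  by (simp add: inner_Rn_def comb_Rn_def sum_distrib_left sum.distrib[symmetric] algebra_simps)

lemma dilated_cap_log_concave:
  assumes K: "convex_body n K"
  shows "log_concave_family n (dilated_cap_indicator n K \<theta>)"
  unfolding log_concave_family_def
proof (intro conjI allI ballI impI)
  note [measurable] = convex_body_sets[OF K]
  let ?F = "dilated_cap_indicator n K \<theta>"
  fix p :: "real \<times> real"
  obtain v w where p: "p = (v, w)" by force
  show "?F p \<in> borel_measurable (lborel_Rn n)"
  proof -
    have "(\<lambda>y. \<lambda>i\<in>{..<n}. y i / v) \<in> lborel_Rn n \<rightarrow>\<^sub>M lborel_Rn n" by measurable
    then show ?thesis unfolding dilated_cap_indicator_def p by (auto intro!: measurable_If pred_intros_logic pred_sets1)
  qed
  show "0 \<le> ?F p x" for x by (simp add: dilated_cap_indicator_def split_beta')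
  show "\<exists>M. \<forall>x\<in>Rn n. ?F p x \<le> M"
    by (rule exI[of _ 1]) (simp add: dilated_cap_indicator_def split_beta')
  show "\<exists>R. \<forall>x\<in>Rn n. ?F p x \<noteq> 0 \<longrightarrow> (\<forall>i<n. \<bar>x i\<bar> \<le> R)"
  proof -
    obtain R where R: "0 < R" "\<And>x i. x \<in> K \<Longrightarrow> i < n \<Longrightarrow> \<bar>x i\<bar> \<le> R"
      using compactin_Rn_bounded K unfolding convex_body_def by metis
    have "\<bar>x i\<bar> \<le> v * R" if "?F p x \<noteq> 0" "i < n" for x i
    proof -
      have v: "0 < v" and x: "(\<lambda>i\<in>{..<n}. x i / v) \<in> K"
        using that by (auto simp: dilated_cap_indicator_def p split: if_splits)
      from R(2)[OF x that(2)] that(2) v show ?thesis by (simp add: field_simps)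
    qed
    then show ?thesis by blast
  qed
next
  let ?F = "dilated_cap_indicator n K \<theta>"
  have cv: "comb_Rn n a x b y \<in> K" if "x \<in> K" "y \<in> K" "0 \<le> a" "0 \<le> b" "a + b = 1" for a b x y
    using K that unfolding convex_body_def convex_Rn_def comb_Rn_def by blast
  fix l :: real and p q :: "real \<times> real" and x y :: "nat \<Rightarrow> real"
  assume l: "0 < l" "l < 1"
  obtain v w where p: "p = (v, w)" by force
  obtain v' w' where q: "q = (v', w')" by force
  show "?F p x powr (1 - l) * ?F q y powr l
      \<le> ?F ((1 - l) *\<^sub>R p + l *\<^sub>R q) (comb_Rn n (1 - l) x l y)"
  proof (cases "?F p x = 0 \<or> ?F q y = 0")
    case True
    then have "?F p x powr (1 - l) * ?F q y powr l = 0" by auto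
    moreover have "0 \<le> ?F r z" for r z by (simp add: dilated_cap_indicator_def split_beta')
    ultimately show ?thesis by (simp only:)
  next
    case False
    then have v: "0 < v" and x: "(\<lambda>i\<in>{..<n}. x i / v) \<in> K" "w \<le> inner_Rn n \<theta> x"
      and v': "0 < v'" and y: "(\<lambda>i\<in>{..<n}. y i / v') \<in> K" "w' \<le> inner_Rn n \<theta> y"
      by (auto simp: dilated_cap_indicator_def p q split: if_splits)
    define V where "V = (1 - l) * v + l * v'"
    have V: "0 < V" using l v v' by (simp add: V_def add_pos_pos)
    have "comb_Rn n ((1 - l) * v / V) (\<lambda>i\<in>{..<n}. x i / v) (l * v' / V) (\<lambda>i\<in>{..<n}. y i / v') \<in> K"
    proof (rule cv[OF x(1) y(1)])
      have "(1 - l) * v / V + l * v' / V = ((1 - l) * v + l * v') / V" by (simp only: add_divide_distrib)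
      then show "(1 - l) * v / V + l * v' / V = 1" using V by (simp add: V_def)
    qed (use l v v' V in auto)
    also have "comb_Rn n ((1 - l) * v / V) (\<lambda>i\<in>{..<n}. x i / v) (l * v' / V) (\<lambda>i\<in>{..<n}. y i / v')
        = (\<lambda>i\<in>{..<n}. comb_Rn n (1 - l) x l y i / V)"
      using v v' by (auto simp: comb_Rn_def fun_eq_iff add_divide_distrib)
    finally have "(\<lambda>i\<in>{..<n}. comb_Rn n (1 - l) x l y i / V) \<in> K" .
    moreover have "(1 - l) * w + l * w' \<le> inner_Rn n \<theta> (comb_Rn n (1 - l) x l y)"
      unfolding inner_Rn_comb using x y l by (intro add_mono mult_left_mono) auto
    ultimately have "?F ((1 - l) *\<^sub>R p + l *\<^sub>R q) (comb_Rn n (1 - l) x l y) = 1"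
      using V by (simp add: dilated_cap_indicator_def p q V_def)
    moreover have "?F p x = 1" "?F q y = 1"
      using v v' x y by (auto simp: dilated_cap_indicator_def p q)
    ultimately show ?thesis by simp
  qed
qed

lemma dilated_cap_volume:
  assumes K: "convex_body n K" and v: "0 < v"
  shows "enn2real (\<integral>\<^sup>+y. dilated_cap_indicator n K \<theta> (v, w) y \<partial>lborel_Rn n) = v ^ n * cap_volume n K \<theta> (w / v)"
proof -
  have "dilated_cap_indicator n K \<theta> (v, w) \<in> borel_measurable (lborel_Rn n)"
    using dilated_cap_log_concave[OF K] by (simp add: log_concave_family_def)
  then have "(\<lambda>y. ennreal (dilated_cap_indicator n K \<theta> (v, w) y)) \<in> borel_measurable (lborel_Rn n)"
    by measurable
  from nn_integral_Rn_scale[OF v this]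
  have "(\<integral>\<^sup>+y. dilated_cap_indicator n K \<theta> (v, w) y \<partial>lborel_Rn n)
      = ennreal (v ^ n) * (\<integral>\<^sup>+y. dilated_cap_indicator n K \<theta> (v, w) (\<lambda>i\<in>{..<n}. v * y i) \<partial>lborel_Rn n)" .
  also have "(\<integral>\<^sup>+y. dilated_cap_indicator n K \<theta> (v, w) (\<lambda>i\<in>{..<n}. v * y i) \<partial>lborel_Rn n)
      = (\<integral>\<^sup>+y. indicator (cap n K \<theta> (w / v)) y \<partial>lborel_Rn n)"
  proof (intro nn_integral_cong)
    fix y assume "y \<in> space (lborel_Rn n)"
    then have y: "y \<in> Rn n" by (simp add: space_PiM)
    have "(\<lambda>i\<in>{..<n}. (\<lambda>i\<in>{..<n}. v * y i) i / v) = y"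
      using y v by (auto simp: fun_eq_iff PiE_iff extensional_def)
    moreover have "inner_Rn n \<theta> (\<lambda>i\<in>{..<n}. v * y i) = v * inner_Rn n \<theta> y"
      by (simp add: inner_Rn_def sum_distrib_left algebra_simps)
    ultimately show "ennreal (dilated_cap_indicator n K \<theta> (v, w) (\<lambda>i\<in>{..<n}. v * y i))
        = indicator (cap n K \<theta> (w / v)) y"
      using v by (auto simp: dilated_cap_indicator_def cap_def indicator_def field_simps)
  qed
  also have "\<dots> = ennreal (cap_volume n K \<theta> (w / v))"
    using cap_sets[OF K] by (simp add: emeasure_cap[OF K])
  finally show ?thesis
    using v by (simp add: ennreal_mult[symmetric] cap_volume_def)
qed

text \<open>
  Dilating each of the two caps to volume \<open>1\<close> gives two parameters at which the fibre volume
  \<open>v\<^sup>n G (w / v)\<close> equals \<open>1\<close>, so by Prekopa it is at least \<open>1\<close> on the segment between them.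
  The weight \<open>k\<close> is the one for which the point of the segment has \<open>w / v = (1 - l) s + l u\<close>; there the
  dilation factor is the inverse of the combination \<open>m\<close> of the two \<open>n\<close>-th roots.
\<close>

lemma brunn_minkowski_caps:
  assumes K: "convex_body n K" and n: "1 \<le> n" and l: "0 < l" "l < 1"
    and s: "0 < cap_volume n K \<theta> s" and u: "0 < cap_volume n K \<theta> u"
  shows "(1 - l) * root n (cap_volume n K \<theta> s) + l * root n (cap_volume n K \<theta> u)
     \<le> root n (cap_volume n K \<theta> ((1 - l) * s + l * u))"
proof -
  define a b where "a = root n (cap_volume n K \<theta> s)" and "b = root n (cap_volume n K \<theta> u)"
  have a: "0 < a" "a ^ n = cap_volume n K \<theta> s" and b: "0 < b" "b ^ n = cap_volume n K \<theta> u"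
    using s u n by (auto simp: a_def b_def)
  define m where "m = (1 - l) * a + l * b"
  have m: "0 < m" using a b l by (simp add: m_def add_pos_pos)
  define k where "k = l * b / m"
  have k: "0 < k" "k < 1" "1 - k = (1 - l) * a / m"
    using a b l m by (auto simp: k_def field_simps) (auto simp: m_def algebra_simps)
  let ?I = "\<lambda>p. enn2real (\<integral>\<^sup>+y. dilated_cap_indicator n K \<theta> p y \<partial>lborel_Rn n)"
  have "?I (1 / a, s / a) = 1" "?I (1 / b, u / b) = 1"
    using a b dilated_cap_volume[OF K, of "1 / a" \<theta> "s / a"] dilated_cap_volume[OF K, of "1 / b" \<theta> "u / b"]
    by (auto simp: power_divide)
  moreover have "(1 - k) *\<^sub>R (1 / a, s / a) + k *\<^sub>R (1 / b, u / b) = (1 / m, ((1 - l) * s + l * u) / m)"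
    unfolding k(3) using a b m by (simp add: k_def field_simps)
  ultimately have "1 \<le> ?I (1 / m, ((1 - l) * s + l * u) / m)"
    using prekopa[OF dilated_cap_log_concave[OF K] k(1,2), of \<theta> "(1 / a, s / a)" "(1 / b, u / b)"] by simp
  also have "\<dots> = cap_volume n K \<theta> ((1 - l) * s + l * u) / m ^ n"
    using m by (subst dilated_cap_volume[OF K]) (auto simp: power_divide)
  finally have "m ^ n \<le> cap_volume n K \<theta> ((1 - l) * s + l * u)"
    using m by (simp add: field_simps)
  then have "root n (m ^ n) \<le> root n (cap_volume n K \<theta> ((1 - l) * s + l * u))"
    using n by simp
  moreover have "root n (m ^ n) = m" using m n by (intro real_root_power_cancel) auto
  ultimately show ?thesis by (simp only: m_def a_def b_def)
qed

section \<open>The reverse Chernoff bound\<close>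

text \<open>
  The weak form of Stirling that produces the factor \<open>\<surd>n\<close>. The quotient of the two sides decreases in
  \<open>n\<close> because \<open>ln (n + 1) - ln n \<ge> 2 / (2 n + 1)\<close>.
\<close>

lemma fact_exp_le_sqrt:
  assumes "1 \<le> n"
  shows "fact n * exp (real n) \<le> exp 1 * sqrt (real n) * real n ^ n"
  using assms
proof (induction n rule: nat_induct_at_least)
  case base
  show ?case by simp
next
  case (Suc n)
  then have n: "0 < real n" by simp
  have ex: "exp ((m + 1/2) * ln x) = sqrt x * x powr m" if "0 < x" for m x :: real
  proof -
    have "exp ((m + 1/2) * ln x) = x powr (m + 1/2)" using that by (simp add: powr_def)
    also have "\<dots> = x powr m * x powr (1/2)" by (rule powr_add)
    also have "x powr (1/2) = sqrt x" using that by (simp add: powr_half_sqrt)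
    finally show ?thesis by (simp add: mult.commute)
  qed
  have "2 * (real (Suc n) - real n) / (real n + real (Suc n)) \<le> ln (real (Suc n)) - ln (real n)"
    using n by (intro ln_inverse_approx_ge) auto
  then have "1 / (real n + 1/2) \<le> ln (real (Suc n)) - ln (real n)"
    by (simp add: field_simps)
  then have "1 \<le> (ln (real (Suc n)) - ln (real n)) * (real n + 1/2)"
    using n by (simp add: pos_divide_le_eq)
  then have "1 + (real n + 1/2) * ln (real n) \<le> (real n + 1/2) * ln (real (Suc n))"
    by (simp add: algebra_simps)
  then have "exp (1 + (real n + 1/2) * ln (real n)) \<le> exp ((real n + 1/2) * ln (real (Suc n)))"
    by simp
  then have step: "exp 1 * (sqrt (real n) * real n ^ n) \<le> sqrt (real (Suc n)) * real (Suc n) ^ n"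
    using n unfolding exp_add by (simp add: ex powr_realpow del: of_nat_Suc)
  have "exp (real (Suc n)) = exp 1 * exp (real n)" by (simp add: exp_add[symmetric])
  then have "fact (Suc n) * exp (real (Suc n)) = real (Suc n) * exp 1 * (fact n * exp (real n))"
    by simp
  also have "\<dots> \<le> real (Suc n) * exp 1 * (exp 1 * sqrt (real n) * real n ^ n)"
    using Suc.IH by (intro mult_left_mono) auto
  also have "\<dots> = real (Suc n) * exp 1 * (exp 1 * (sqrt (real n) * real n ^ n))" by simp
  also have "\<dots> \<le> real (Suc n) * exp 1 * (sqrt (real (Suc n)) * real (Suc n) ^ n)"
    using step by (intro mult_left_mono) auto
  finally show ?case by (simp add: mult_ac)
qed

text \<open>
  The \<open>n\<close>-th root of the cap volume is concave where it is positive, so it lies below a supporting line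
  at \<open>s\<close>; positivity slightly above \<open>s\<close> makes \<open>s\<close> an interior point. The slope is not positive
  because caps shrink as the height grows. Heights at which the cap is null satisfy the bound trivially.
\<close>

lemma cap_volume_supporting_line:
  assumes K: "convex_body n K" and n: "1 \<le> n" and d: "0 < d" "0 < cap_volume n K \<theta> (s + d)"
  obtains k where "0 \<le> k" "\<And>u. cap_volume n K \<theta> u \<le> cap_volume n K \<theta> s * max 0 (1 - k * (u - s)) ^ n"
proof -
  define I where "I = {u. 0 < cap_volume n K \<theta> u}"
  define f where "f u = - root n (cap_volume n K \<theta> u)" for u
  have down: "u \<in> I" if "v \<in> I" "u \<le> v" for u v
    using cap_volume_antimono[OF K that(2), of \<theta>] that(1) by (simp add: I_def)
  have "is_interval I" unfolding is_interval_1 using down by blast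
  then have cI: "convex I" by (simp add: is_interval_convex_1)
  have conv: "convex_on I f"
  proof (rule convex_onI[OF _ cI])
    fix t x y :: real assume "0 < t" "t < 1" "x \<in> I" "y \<in> I"
    then show "f ((1 - t) *\<^sub>R x + t *\<^sub>R y) \<le> (1 - t) * f x + t * f y"
      using brunn_minkowski_caps[OF K n, of t \<theta> x y] by (simp add: I_def f_def)
  qed
  have "{..<s + d} \<subseteq> I" using down[of "s + d"] d by (auto simp: I_def)
  then have int: "s \<in> interior I" using d(1) by (intro interiorI[of "{..<s + d}"]) auto
  then have sI: "s \<in> I" using interior_subset by blast
  define m where "m = Inf ((\<lambda>t. (f s - f t) / (s - t)) ` ({s<..} \<inter> I))"
  have le: "root n (cap_volume n K \<theta> u) \<le> root n (cap_volume n K \<theta> s) - m * (u - s)" if "u \<in> I" for u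
    using convex_le_Inf_differential[OF conv int that] by (simp add: f_def m_def)
  have m: "0 \<le> m"
  proof -
    have "root n (cap_volume n K \<theta> s) \<le> root n (cap_volume n K \<theta> (s - 1))"
      using n cap_volume_antimono[OF K, of "s - 1" s \<theta>] by simp
    also have "\<dots> \<le> root n (cap_volume n K \<theta> s) - m * ((s - 1) - s)"
      by (intro le down[OF sI]) simp
    finally show ?thesis by simp
  qed
  define g where "g = root n (cap_volume n K \<theta> s)"
  have g: "0 < g" "g ^ n = cap_volume n K \<theta> s" using sI n by (auto simp: g_def I_def)
  show ?thesis
  proof (rule that)
    show "0 \<le> m / g" using m g by simp
    fix u
    show "cap_volume n K \<theta> u \<le> cap_volume n K \<theta> s * max 0 (1 - m / g * (u - s)) ^ n"
    proof (cases "u \<in> I")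
      case False
      then have "cap_volume n K \<theta> u \<le> 0" by (simp add: I_def)
      also have "0 \<le> cap_volume n K \<theta> s * max 0 (1 - m / g * (u - s)) ^ n"
        by (simp add: cap_volume_def)
      finally show ?thesis .
    next
      case True
      have r: "root n (cap_volume n K \<theta> u) ^ n = cap_volume n K \<theta> u" "0 \<le> root n (cap_volume n K \<theta> u)"
        using n by (auto simp: cap_volume_def)
      have "root n (cap_volume n K \<theta> u) \<le> g - m * (u - s)" using le[OF True] by (simp add: g_def)
      also have "\<dots> = g * (1 - m / g * (u - s))" using g by (simp add: field_simps)
      also have "\<dots> \<le> g * max 0 (1 - m / g * (u - s))" using g by (intro mult_left_mono) auto
      finally have "root n (cap_volume n K \<theta> u) ^ n \<le> (g * max 0 (1 - m / g * (u - s))) ^ n"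
        using r by (intro power_mono)
      then show ?thesis by (simp add: r power_mult_distrib g)
    qed
  qed
qed

lemma nn_integral_exp_Iic:
  fixes t a s :: real
  assumes t: "0 < t"
  shows "(\<integral>\<^sup>+u. (if u \<le> a then ennreal (t * exp (t * (u - s))) else 0) \<partial>lborel) = ennreal (exp (t * (a - s)))"
proof -
  have "(\<integral>\<^sup>+u. (if u \<le> a then ennreal (t * exp (t * (u - s))) else 0) \<partial>lborel)
      = ennreal \<bar>- 1 / t\<bar> * (\<integral>\<^sup>+w. (if a + (- 1 / t) * w \<le> a then ennreal (t * exp (t * (a + (- 1 / t) * w - s))) else 0) \<partial>lborel)"
    using t by (intro nn_integral_real_affine) auto
  also have "(\<integral>\<^sup>+w. (if a + (- 1 / t) * w \<le> a then ennreal (t * exp (t * (a + (- 1 / t) * w - s))) else 0) \<partial>lborel)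
      = (\<integral>\<^sup>+w. ennreal (t * exp (t * (a - s))) * (ennreal (w ^ 0 * exp (- w)) * indicator {0..} w) \<partial>lborel)"
  proof (intro nn_integral_cong)
    fix w
    have "t * (a + (- 1 / t) * w - s) = t * (a - s) + - w" using t by (simp add: field_simps)
    then have "exp (t * (a + (- 1 / t) * w - s)) = exp (t * (a - s)) * exp (- w)"
      by (simp only: exp_add)
    then show "(if a + (- 1 / t) * w \<le> a then ennreal (t * exp (t * (a + (- 1 / t) * w - s))) else 0)
      = ennreal (t * exp (t * (a - s))) * (ennreal (w ^ 0 * exp (- w)) * indicator {0..} w)"
      using t by (auto simp: ennreal_mult[symmetric] mult.assoc zero_le_divide_iff)
  qed
  also have "\<dots> = ennreal (t * exp (t * (a - s)))"
    by (subst nn_integral_cmult) (auto simp: nn_intergal_power_times_exp_Ici[of 0, simplified])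
  also have "ennreal \<bar>- 1 / t\<bar> * \<dots> = ennreal (exp (t * (a - s)))"
    using t by (simp add: ennreal_mult[symmetric])
  finally show ?thesis .
qed

text \<open>
  Write the exponential as the integral of its derivative up to \<open>\<langle>\<theta>, y\<rangle>\<close> and exchange the integrals.
\<close>

lemma exp_integral_eq_cap_volumes:
  assumes K: "convex_body n K" and t: "0 < t"
  shows "(\<integral>\<^sup>+y. ennreal (exp (t * (inner_Rn n \<theta> y - s))) * indicator K y \<partial>lborel_Rn n)
       = (\<integral>\<^sup>+u. ennreal (t * exp (t * (u - s)) * cap_volume n K \<theta> u) \<partial>lborel)"
proof -
  interpret product_sigma_finite "\<lambda>_. lborel :: real measure" by standard
  interpret P: sigma_finite_measure "lborel_Rn n" by (rule sigma_finite) simp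
  interpret pair_sigma_finite "lborel_Rn n" "lborel :: real measure" by standard
  note [measurable] = convex_body_sets[OF K]
  let ?h = "\<lambda>y u. (if u \<le> inner_Rn n \<theta> y then ennreal (t * exp (t * (u - s))) else 0) * indicator K y"
  have "(\<integral>\<^sup>+y. ennreal (exp (t * (inner_Rn n \<theta> y - s))) * indicator K y \<partial>lborel_Rn n)
      = (\<integral>\<^sup>+y. \<integral>\<^sup>+u. ?h y u \<partial>lborel \<partial>lborel_Rn n)"
    by (intro nn_integral_cong) (simp add: nn_integral_multc nn_integral_exp_Iic[OF t])
  also have "\<dots> = (\<integral>\<^sup>+u. \<integral>\<^sup>+y. ?h y u \<partial>lborel_Rn n \<partial>lborel)"
    by (rule Fubini'[symmetric]) measurable
  also have "\<dots> = (\<integral>\<^sup>+u. ennreal (t * exp (t * (u - s)) * cap_volume n K \<theta> u) \<partial>lborel)"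
  proof (intro nn_integral_cong)
    fix u
    have "(\<integral>\<^sup>+y. ?h y u \<partial>lborel_Rn n)
        = (\<integral>\<^sup>+y. ennreal (t * exp (t * (u - s))) * indicator (cap n K \<theta> u) y \<partial>lborel_Rn n)"
      by (intro nn_integral_cong) (auto simp: cap_def indicator_def)
    also have "\<dots> = ennreal (t * exp (t * (u - s))) * ennreal (cap_volume n K \<theta> u)"
      using cap_sets[OF K] by (simp add: nn_integral_cmult emeasure_cap[OF K])
    also have "\<dots> = ennreal (t * exp (t * (u - s)) * cap_volume n K \<theta> u)"
      using t by (simp add: ennreal_mult cap_volume_def)
    finally show "(\<integral>\<^sup>+y. ?h y u \<partial>lborel_Rn n) = ennreal (t * exp (t * (u - s)) * cap_volume n K \<theta> u)" .
  qed
  finally show ?thesis .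
qed

text \<open>
  The substitution \<open>w = n (1 - k (u - s))\<close> turns the exponent into \<open>n - w\<close> and leaves the Gamma
  integral of \<open>w\<^sup>n\<close>. The exponent \<open>t = n k\<close> is the one that minimises \<open>e\<^sup>\<tau> / \<tau>\<^sup>n\<close>, where
  \<open>\<tau> = t / k\<close>.
\<close>

lemma gamma_integral_supporting_line:
  fixes k s G :: real
  assumes k: "0 < k" and n: "1 \<le> n" and G: "0 \<le> G"
  defines "t \<equiv> real n * k"
  shows "(\<integral>\<^sup>+u. ennreal (t * exp (t * (u - s)) * (G * max 0 (1 - k * (u - s)) ^ n)) \<partial>lborel)
       = ennreal (G * (fact n * exp (real n) / real n ^ n))"
proof -
  have t: "0 < t" using k n by (simp add: t_def)
  have n0: "0 < real n" using n by simp
  have "(\<integral>\<^sup>+u. ennreal (t * exp (t * (u - s)) * (G * max 0 (1 - k * (u - s)) ^ n)) \<partial>lborel)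
      = ennreal \<bar>- 1 / t\<bar> * (\<integral>\<^sup>+w. ennreal (t * exp (t * ((s + 1 / k) + (- 1 / t) * w - s))
          * (G * max 0 (1 - k * ((s + 1 / k) + (- 1 / t) * w - s)) ^ n)) \<partial>lborel)"
    using t by (intro nn_integral_real_affine) auto
  also have "(\<integral>\<^sup>+w. ennreal (t * exp (t * ((s + 1 / k) + (- 1 / t) * w - s))
          * (G * max 0 (1 - k * ((s + 1 / k) + (- 1 / t) * w - s)) ^ n)) \<partial>lborel)
      = (\<integral>\<^sup>+w. ennreal (t * G * exp (real n) / real n ^ n) * (ennreal (w ^ n * exp (- w)) * indicator {0..} w) \<partial>lborel)"
  proof (intro nn_integral_cong)
    fix w
    have "t * ((s + 1 / k) + (- 1 / t) * w - s) = real n + - w"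
      using k t n0 unfolding t_def by (simp add: field_simps)
    then have e: "exp (t * ((s + 1 / k) + (- 1 / t) * w - s)) = exp (real n) * exp (- w)"
      by (simp only: exp_add)
    have l: "1 - k * ((s + 1 / k) + (- 1 / t) * w - s) = w / real n"
      using k n0 unfolding t_def by (simp add: field_simps)
    show "ennreal (t * exp (t * ((s + 1 / k) + (- 1 / t) * w - s))
          * (G * max 0 (1 - k * ((s + 1 / k) + (- 1 / t) * w - s)) ^ n))
        = ennreal (t * G * exp (real n) / real n ^ n) * (ennreal (w ^ n * exp (- w)) * indicator {0..} w)"
    proof (cases "0 \<le> w")
      case True
      then have "max 0 (w / real n) ^ n = w ^ n / real n ^ n" by (simp add: power_divide)
      then have "t * (exp (real n) * exp (- w)) * (G * max 0 (w / real n) ^ n)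
          = t * G * exp (real n) / real n ^ n * (w ^ n * exp (- w))" by simp
      then show ?thesis unfolding e l using True t G by (simp add: ennreal_mult[symmetric])
    next
      case False
      then have "max 0 (w / real n) = 0" using n0 by (simp add: divide_nonpos_pos)
      then show ?thesis unfolding e l using False n0 by (simp add: power_0_left)
    qed
  qed
  also have "\<dots> = ennreal (t * G * exp (real n) / real n ^ n) * ennreal (fact n)"
    by (subst nn_integral_cmult) (auto simp: nn_intergal_power_times_exp_Ici)
  also have "ennreal \<bar>- 1 / t\<bar> * \<dots> = ennreal (G * (fact n * exp (real n) / real n ^ n))"
  proof -
    have "(1 / t) * (t * G * exp (real n) / real n ^ n * fact n) = G * (fact n * exp (real n) / real n ^ n)"
      using t by simp
    then show ?thesis using t G by (simp add: ennreal_mult[symmetric])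
  qed
  finally show ?thesis .
qed

lemma inner_Rn_bounded_on_body:
  assumes "convex_body n K"
  obtains B where "\<And>y. y \<in> K \<Longrightarrow> \<bar>inner_Rn n \<theta> y\<bar> \<le> B"
proof -
  obtain R where R: "0 < R" "\<And>x i. x \<in> K \<Longrightarrow> i < n \<Longrightarrow> \<bar>x i\<bar> \<le> R"
    using compactin_Rn_bounded assms unfolding convex_body_def by metis
  have "\<bar>inner_Rn n \<theta> y\<bar> \<le> (\<Sum>i<n. \<bar>\<theta> i\<bar> * R)" if "y \<in> K" for y
  proof -
    have "\<bar>inner_Rn n \<theta> y\<bar> \<le> (\<Sum>i<n. \<bar>\<theta> i * y i\<bar>)"
      unfolding inner_Rn_def by (rule sum_abs)
    also have "\<dots> \<le> (\<Sum>i<n. \<bar>\<theta> i\<bar> * R)"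
      using R(2)[OF that] by (intro sum_mono) (auto simp: abs_mult intro!: mult_left_mono)
    finally show ?thesis .
  qed
  then show ?thesis by (rule that)
qed

text \<open>
  Chernoff's bound read backwards: for a good exponent, the exponential moment exceeds the volume of
  the cap by a factor of at most \<open>e \<surd>n\<close>. Replacing the cap volumes by their bound from the
  supporting line leaves the Gamma integral. If that line is horizontal, the cap at \<open>s\<close> has the full volume
  of the body and the exponent \<open>0\<close> suffices.
\<close>

lemma exists_chernoff_exponent:
  assumes K: "convex_body n K" and n: "1 \<le> n" and d: "0 < d" "0 < cap_volume n K \<theta> (s + d)"
  shows "\<exists>t. (\<integral>\<^sup>+y. ennreal (exp (t * (inner_Rn n \<theta> y - s))) * indicator K y \<partial>lborel_Rn n)
       \<le> ennreal (exp 1 * sqrt (real n) * cap_volume n K \<theta> s)"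
proof -
  obtain k where k: "0 \<le> k" "\<And>u. cap_volume n K \<theta> u \<le> cap_volume n K \<theta> s * max 0 (1 - k * (u - s)) ^ n"
    by (rule cap_volume_supporting_line[OF K n d]) blast
  have G: "0 \<le> cap_volume n K \<theta> s" by (simp add: cap_volume_def)
  show ?thesis
  proof (cases "k = 0")
    case True
    obtain B where B: "\<And>y. y \<in> K \<Longrightarrow> \<bar>inner_Rn n \<theta> y\<bar> \<le> B"
      by (rule inner_Rn_bounded_on_body[OF K, of \<theta>]) blast
    have "- B \<le> inner_Rn n \<theta> y" if "y \<in> K" for y using B[OF that] by linarith
    then have "cap n K \<theta> (- B) = K" by (auto simp: cap_def)
    then have "emeasure (lborel_Rn n) K \<le> ennreal (cap_volume n K \<theta> s)"
      using emeasure_cap[OF K, of \<theta> "- B"] k(2)[of "- B"] True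
      by (simp add: ennreal_leI)
    also have "\<dots> \<le> ennreal (exp 1 * sqrt (real n) * cap_volume n K \<theta> s)"
    proof (intro ennreal_leI)
      have "1 * 1 \<le> exp 1 * sqrt (real n)" using n by (intro mult_mono) auto
      then have "1 * cap_volume n K \<theta> s \<le> exp 1 * sqrt (real n) * cap_volume n K \<theta> s"
        using G by (intro mult_right_mono) auto
      then show "cap_volume n K \<theta> s \<le> exp 1 * sqrt (real n) * cap_volume n K \<theta> s" by simp
    qed
    finally show ?thesis
      using convex_body_sets[OF K] by (intro exI[of _ 0]) simp
  next
    case False
    then have k0: "0 < k" using k(1) by simp
    define t where "t = real n * k"
    have t: "0 < t" using k0 n by (simp add: t_def)
    have "(\<integral>\<^sup>+y. ennreal (exp (t * (inner_Rn n \<theta> y - s))) * indicator K y \<partial>lborel_Rn n)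
        = (\<integral>\<^sup>+u. ennreal (t * exp (t * (u - s)) * cap_volume n K \<theta> u) \<partial>lborel)"
      by (rule exp_integral_eq_cap_volumes[OF K t])
    also have "\<dots> \<le> (\<integral>\<^sup>+u. ennreal (t * exp (t * (u - s)) * (cap_volume n K \<theta> s * max 0 (1 - k * (u - s)) ^ n)) \<partial>lborel)"
      using t by (intro nn_integral_mono ennreal_leI mult_left_mono k(2)) auto
    also have "\<dots> = ennreal (cap_volume n K \<theta> s * (fact n * exp (real n) / real n ^ n))"
      unfolding t_def by (rule gamma_integral_supporting_line[OF k0 n G])
    also have "\<dots> \<le> ennreal (cap_volume n K \<theta> s * (exp 1 * sqrt (real n)))"
      using fact_exp_le_sqrt[OF n] n G
      by (intro ennreal_leI mult_left_mono) (auto simp: divide_le_eq)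
    finally show ?thesis by (auto simp: mult_ac)
  qed
qed

text \<open>
  Around an interior point \<open>x\<close>, the cube of half-side \<open>r\<close> contains a smaller cube that is moved off \<open>x\<close>
  in the direction of the signs of \<open>\<theta>\<close>; all its points are higher than \<open>x\<close> by at least
  \<open>d\<close>.
\<close>

lemma cap_volume_interior_pos:
  assumes K: "convex_body n K" and x: "x \<in> Rn_topology n interior_of K" and \<theta>: "i < n" "\<theta> i \<noteq> 0"
  obtains d where "0 < d" "0 < cap_volume n K \<theta> (inner_Rn n \<theta> x + d)"
proof -
  obtain r where r: "0 < r" "(\<Pi>\<^sub>E i\<in>{..<n}. {x i - r<..<x i + r}) \<subseteq> K"
    by (rule interior_of_Rn_cube[OF x]) blast
  \<comment> \<open>Half-side r/4 around this centre: each coordinate with \<open>\<theta> i \<noteq> 0\<close> is displaced by between r/2 and r.\<close>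
  define c where "c i = x i + 3 * r / 4 * sgn (\<theta> i)" for i
  define B where "B = (\<Pi>\<^sub>E i\<in>{..<n}. {c i - r / 4<..<c i + r / 4})"
  define d where "d = (\<Sum>i<n. \<bar>\<theta> i\<bar> * (r / 2))"
  have d: "0 < d" unfolding d_def using \<theta> r(1) by (intro sum_pos2[of _ i]) auto
  have "B \<subseteq> cap n K \<theta> (inner_Rn n \<theta> x + d)"
  proof
    fix y assume y: "y \<in> B"
    then have yi: "c i - r / 4 < y i" "y i < c i + r / 4" if "i < n" for i
      using that by (auto simp: B_def PiE_iff)
    have "y \<in> (\<Pi>\<^sub>E i\<in>{..<n}. {x i - r<..<x i + r})"
    proof (rule PiE_I)
      fix i assume "i \<in> {..<n}"
      then have "c i - r / 4 < y i" "y i < c i + r / 4" using yi by auto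
      then show "y i \<in> {x i - r<..<x i + r}"
        using r(1) by (cases "\<theta> i" "0::real" rule: linorder_cases) (auto simp: c_def)
    qed (use y in \<open>auto simp: B_def PiE_iff extensional_def\<close>)
    then have "y \<in> K" using r(2) by blast
    moreover have "inner_Rn n \<theta> x + d \<le> inner_Rn n \<theta> y"
      unfolding inner_Rn_def d_def sum.distrib[symmetric]
    proof (intro sum_mono)
      fix i assume "i \<in> {..<n}"
      then have "c i - r / 4 < y i" "y i < c i + r / 4" using yi by auto
      then have "\<bar>\<theta> i\<bar> * (r / 2) \<le> \<theta> i * (y i - x i)"
      proof (cases "\<theta> i" "0::real" rule: linorder_cases)
        case less
        have "(- \<theta> i) * (r / 2) \<le> (- \<theta> i) * (x i - y i)"
          using less yi[of i] \<open>i \<in> {..<n}\<close> by (intro mult_left_mono) (auto simp: c_def)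
        then show ?thesis using less by (simp add: algebra_simps)
      next
        case greater
        have "\<theta> i * (r / 2) \<le> \<theta> i * (y i - x i)"
          using greater yi[of i] \<open>i \<in> {..<n}\<close> by (intro mult_left_mono) (auto simp: c_def)
        then show ?thesis using greater by simp
      qed simp
      then show "\<theta> i * x i + \<bar>\<theta> i\<bar> * (r / 2) \<le> \<theta> i * y i" by (simp add: algebra_simps)
    qed
    ultimately show "y \<in> cap n K \<theta> (inner_Rn n \<theta> x + d)" by (simp add: cap_def)
  qed
  then have "emeasure (lborel_Rn n) B \<le> emeasure (lborel_Rn n) (cap n K \<theta> (inner_Rn n \<theta> x + d))"
    using cap_sets[OF K] by (intro emeasure_mono)
  moreover have "emeasure (lborel_Rn n) B = ennreal ((2 * (r / 4)) ^ n)"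
    unfolding B_def using r(1) by (intro emeasure_cube_Rn) simp
  ultimately have "ennreal ((2 * (r / 4)) ^ n) \<le> ennreal (cap_volume n K \<theta> (inner_Rn n \<theta> x + d))"
    by (simp add: emeasure_cap[OF K])
  then have "(2 * (r / 4)) ^ n \<le> cap_volume n K \<theta> (inner_Rn n \<theta> x + d)"
    by (subst (asm) ennreal_le_iff) (auto simp: cap_volume_def)
  moreover have "0 < (2 * (r / 4)) ^ n" using r(1) by simp
  ultimately show ?thesis using d that by fastforce
qed

section \<open>The Cramer transform and the half-space depth\<close>

definition laplace :: "nat \<Rightarrow> (nat \<Rightarrow> real) set \<Rightarrow> (nat \<Rightarrow> real) \<Rightarrow> real" where
  "laplace n K \<theta> = enn2real (\<integral>\<^sup>+y. ennreal (exp (inner_Rn n \<theta> y)) \<partial>uniform_prob n K)"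

lemma convex_body_emeasure:
  assumes K: "convex_body n K"
  shows "emeasure (lborel_Rn n) K = ennreal (measure (lborel_Rn n) K)" "0 < measure (lborel_Rn n) K"
proof -
  show e: "emeasure (lborel_Rn n) K = ennreal (measure (lborel_Rn n) K)"
    using convex_body_emeasure_finite[OF K] by (intro emeasure_eq_ennreal_measure) auto
  obtain x where "x \<in> Rn_topology n interior_of K" using K by (auto simp: convex_body_def)
  then obtain r where r: "0 < r" "(\<Pi>\<^sub>E i\<in>{..<n}. {x i - r<..<x i + r}) \<subseteq> K"
    by (rule interior_of_Rn_cube) blast
  have "ennreal ((2 * r) ^ n) \<le> emeasure (lborel_Rn n) K"
    using emeasure_mono[OF r(2) convex_body_sets[OF K]] emeasure_cube_Rn[OF r(1), of n x] by simp
  then have "(2 * r) ^ n \<le> measure (lborel_Rn n) K"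
    by (simp add: e)
  moreover have "0 < (2 * r) ^ n" using r(1) by simp
  ultimately show "0 < measure (lborel_Rn n) K" by linarith
qed

lemma prob_space_uniform_prob:
  assumes "convex_body n K"
  shows "prob_space (uniform_prob n K)"
  unfolding uniform_prob_def
  using convex_body_emeasure[OF assms] by (intro prob_space_uniform_measure) auto

lemma sets_uniform_prob: "sets (uniform_prob n K) = sets (lborel_Rn n)"
  by (simp add: uniform_prob_def)

lemma nn_integral_uniform_prob_exp:
  assumes K: "convex_body n K"
  shows "(\<integral>\<^sup>+y. ennreal (exp (inner_Rn n \<theta> y)) \<partial>uniform_prob n K) = ennreal (laplace n K \<theta>)"
    "0 < laplace n K \<theta>"
proof -
  interpret prob_space "uniform_prob n K" by (rule prob_space_uniform_prob[OF K])
  let ?V = "measure (lborel_Rn n) K"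
  note [measurable] = convex_body_sets[OF K]
  note V = convex_body_emeasure[OF K]
  obtain B where B: "\<And>y. y \<in> K \<Longrightarrow> \<bar>inner_Rn n \<theta> y\<bar> \<le> B"
    by (rule inner_Rn_bounded_on_body[OF K, of \<theta>]) blast
  let ?L = "\<integral>\<^sup>+y. ennreal (exp (inner_Rn n \<theta> y)) \<partial>uniform_prob n K"
  have ae: "AE y in uniform_prob n K. \<bar>inner_Rn n \<theta> y\<bar> \<le> B"
    unfolding uniform_prob_def by (rule AE_uniform_measureI) (simp_all add: B)
  have "?L \<le> (\<integral>\<^sup>+y. ennreal (exp B) \<partial>uniform_prob n K)"
    by (rule nn_integral_mono_AE, use ae in eventually_elim) (simp add: abs_le_iff ennreal_leI)
  then have up: "?L \<le> ennreal (exp B)" by (simp add: emeasure_space_1)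
  have "(\<integral>\<^sup>+y. ennreal (exp (- B)) \<partial>uniform_prob n K) \<le> ?L"
    by (rule nn_integral_mono_AE, use ae in eventually_elim) (simp add: abs_le_iff ennreal_leI)
  then have low: "ennreal (exp (- B)) \<le> ?L" by (simp add: emeasure_space_1)
  show e: "?L = ennreal (laplace n K \<theta>)"
    unfolding laplace_def
    by (rule ennreal_enn2real[symmetric]) (rule le_less_trans[OF up], simp)
  have "exp (- B) \<le> laplace n K \<theta>"
    using low unfolding e by (subst (asm) ennreal_le_iff) (auto simp: laplace_def)
  then show "0 < laplace n K \<theta>" using exp_gt_zero[of "- B"] by linarith
qed

lemma closed_halfspace_sets:
  assumes "closed_halfspace n H"
  shows "H \<in> sets (lborel_Rn n)"
proof -
  obtain \<theta> a where H: "H = {y \<in> Rn n. a \<le> inner_Rn n \<theta> y}"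
    using assms unfolding closed_halfspace_def by blast
  have "{y \<in> space (lborel_Rn n). a \<le> inner_Rn n \<theta> y} \<in> sets (lborel_Rn n)" by measurable
  then show ?thesis by (simp only: space_lborel_Rn H)
qed

lemma closed_halfspace_through:
  assumes "1 \<le> n" "x \<in> Rn n"
  obtains H where "closed_halfspace n H" "x \<in> H"
proof (rule that)
  define e where "e = (\<lambda>i\<in>{..<n}. 1 :: real)"
  have "e \<in> Rn n" by (simp add: e_def)
  moreover have "0 < n" "e 0 \<noteq> 0" using assms(1) by (auto simp: e_def)
  ultimately show "closed_halfspace n {y \<in> Rn n. inner_Rn n e x \<le> inner_Rn n e y}"
    unfolding closed_halfspace_def by blast
  show "x \<in> {y \<in> Rn n. inner_Rn n e x \<le> inner_Rn n e y}" using assms(2) by blast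
qed

lemma tukey_body_nonneg:
  assumes "1 \<le> n" "x \<in> Rn n"
  shows "0 \<le> tukey_body n K x"
  unfolding tukey_depth_def
proof (rule cINF_greatest)
  show "{H. closed_halfspace n H \<and> x \<in> H} \<noteq> {}"
    using closed_halfspace_through[OF assms] by blast
qed simp

lemma cramer_body_eq:
  assumes "convex_body n K"
  shows "cramer_body n K x = (SUP \<theta>\<in>Rn n. ereal (inner_Rn n \<theta> x - ln (laplace n K \<theta>)))"
proof -
  have "log_laplace n (uniform_prob n K) \<theta> = ereal (ln (laplace n K \<theta>))" for \<theta>
    using nn_integral_uniform_prob_exp[OF assms, of \<theta>]
    by (simp add: log_laplace_def elog_def)
  then show ?thesis by (simp add: cramer_transform_def)
qed

text \<open>
  Markov's inequality for \<open>y \<mapsto> e\<close> to the power \<open>\<langle>\<theta>, y - x\<rangle>\<close> and the half-space through \<open>x\<close> with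
  normal \<open>\<theta>\<close>. The zero functional defines no half-space; then the right-hand side is \<open>1\<close> and
  any half-space through \<open>x\<close> will do.
\<close>

lemma tukey_body_le_laplace:
  assumes K: "convex_body n K" and n: "1 \<le> n" and x: "x \<in> Rn n" and \<theta>: "\<theta> \<in> Rn n"
  shows "tukey_body n K x \<le> exp (- inner_Rn n \<theta> x) * laplace n K \<theta>"
proof -
  interpret prob_space "uniform_prob n K" by (rule prob_space_uniform_prob[OF K])
  have le: "tukey_body n K x \<le> measure (uniform_prob n K) H" if "closed_halfspace n H" "x \<in> H" for H
    unfolding tukey_depth_def using that by (intro cINF_lower bdd_belowI2[of _ 0]) auto
  have lap: "measure (uniform_prob n K) H \<le> exp (- inner_Rn n \<theta> x) * laplace n K \<theta>"
    if H: "H \<in> sets (lborel_Rn n)" "\<And>y. y \<in> H \<Longrightarrow> inner_Rn n \<theta> x \<le> inner_Rn n \<theta> y" for H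
  proof -
    have "ennreal (measure (uniform_prob n K) H) = (\<integral>\<^sup>+y. indicator H y \<partial>uniform_prob n K)"
      using H(1) by (simp add: emeasure_eq_measure sets_uniform_prob)
    also have "\<dots> \<le> (\<integral>\<^sup>+y. ennreal (exp (- inner_Rn n \<theta> x)) * ennreal (exp (inner_Rn n \<theta> y)) \<partial>uniform_prob n K)"
    proof (intro nn_integral_mono)
      fix y
      have "1 \<le> exp (- inner_Rn n \<theta> x + inner_Rn n \<theta> y)" if "y \<in> H" using H(2)[OF that] by simp
      then show "indicator H y \<le> ennreal (exp (- inner_Rn n \<theta> x)) * ennreal (exp (inner_Rn n \<theta> y))"
        by (auto simp: indicator_def ennreal_mult[symmetric] exp_add[symmetric])
    qed
    also have "\<dots> = ennreal (exp (- inner_Rn n \<theta> x)) * ennreal (laplace n K \<theta>)"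
      unfolding nn_integral_uniform_prob_exp(1)[OF K, symmetric]
      by (intro nn_integral_cmult) (simp add: uniform_prob_def)
    also have "\<dots> = ennreal (exp (- inner_Rn n \<theta> x) * laplace n K \<theta>)"
      by (simp add: ennreal_mult laplace_def)
    finally show ?thesis by (subst (asm) ennreal_le_iff) (auto simp: laplace_def)
  qed
  show ?thesis
  proof (cases "\<exists>i<n. \<theta> i \<noteq> 0")
    case True
    define H where "H = {y \<in> Rn n. inner_Rn n \<theta> x \<le> inner_Rn n \<theta> y}"
    have H: "closed_halfspace n H" unfolding closed_halfspace_def H_def using True \<theta> by blast
    moreover have "x \<in> H" using x unfolding H_def by blast
    ultimately have "tukey_body n K x \<le> measure (uniform_prob n K) H" by (rule le)
    also have "\<dots> \<le> exp (- inner_Rn n \<theta> x) * laplace n K \<theta>"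
      by (rule lap[OF closed_halfspace_sets[OF H]]) (simp add: H_def)
    finally show ?thesis .
  next
    case False
    then have z: "inner_Rn n \<theta> y = 0" for y by (simp add: inner_Rn_def)
    obtain H where H: "closed_halfspace n H" "x \<in> H"
      by (rule closed_halfspace_through[OF n x]) blast
    then have "tukey_body n K x \<le> measure (uniform_prob n K) H" by (rule le)
    also have "\<dots> \<le> exp (- inner_Rn n \<theta> x) * laplace n K \<theta>"
      by (rule lap[OF closed_halfspace_sets[OF H(1)]]) (simp add: z)
    finally show ?thesis .
  qed
qed

text \<open>
  A half-space containing \<open>x\<close> may be pushed until \<open>x\<close> is on its boundary, which only lowers its
  measure. The reverse Chernoff bound at the height of \<open>x\<close> then supplies the functional, a multiple of the
  normal.
\<close>

lemma laplace_le_halfspace_measure: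
  assumes K: "convex_body n K" and n: "1 \<le> n" and x: "x \<in> Rn_topology n interior_of K"
    and H: "closed_halfspace n H" "x \<in> H"
  shows "\<exists>\<phi>\<in>Rn n. laplace n K \<phi> \<le> exp (inner_Rn n \<phi> x) * (exp 1 * sqrt (real n) * measure (uniform_prob n K) H)"
proof -
  obtain \<theta> a where \<theta>: "\<theta> \<in> Rn n" "\<exists>i<n. \<theta> i \<noteq> 0" and Heq: "H = {y \<in> Rn n. a \<le> inner_Rn n \<theta> y}"
    using H(1) unfolding closed_halfspace_def by blast
  define s where "s = inner_Rn n \<theta> x"
  have as: "a \<le> s" using H(2) unfolding Heq s_def by blast
  let ?V = "measure (lborel_Rn n) K"
  note V = convex_body_emeasure[OF K]
  note [measurable] = convex_body_sets[OF K]
  obtain i where i: "i < n" "\<theta> i \<noteq> 0" using \<theta>(2) by blast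
  obtain d where d: "0 < d" "0 < cap_volume n K \<theta> (s + d)"
    unfolding s_def by (rule cap_volume_interior_pos[OF K x i(1), of \<theta>, OF i(2)]) blast
  obtain t where t: "(\<integral>\<^sup>+y. ennreal (exp (t * (inner_Rn n \<theta> y - s))) * indicator K y \<partial>lborel_Rn n)
       \<le> ennreal (exp 1 * sqrt (real n) * cap_volume n K \<theta> s)"
    using exists_chernoff_exponent[OF K n d] by blast
  define \<phi> where "\<phi> = (\<lambda>i\<in>{..<n}. t * \<theta> i)"
  have \<phi>: "\<phi> \<in> Rn n" by (simp add: \<phi>_def)
  have in\<phi>: "inner_Rn n \<phi> y = t * inner_Rn n \<theta> y" for y
    by (simp add: inner_Rn_def \<phi>_def sum_distrib_left mult.assoc)
  have "ennreal (laplace n K \<phi>)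
      = (\<integral>\<^sup>+y. ennreal (exp (inner_Rn n \<phi> y)) * indicator K y \<partial>lborel_Rn n) / ennreal ?V"
    unfolding nn_integral_uniform_prob_exp(1)[OF K, symmetric] uniform_prob_def
    using V by (subst nn_integral_uniform_measure) auto
  also have "(\<integral>\<^sup>+y. ennreal (exp (inner_Rn n \<phi> y)) * indicator K y \<partial>lborel_Rn n)
      = (\<integral>\<^sup>+y. ennreal (exp (t * s)) * (ennreal (exp (t * (inner_Rn n \<theta> y - s))) * indicator K y) \<partial>lborel_Rn n)"
  proof (intro nn_integral_cong)
    fix y
    have "exp (inner_Rn n \<phi> y) = exp (t * s) * exp (t * (inner_Rn n \<theta> y - s))"
      by (simp add: in\<phi> exp_add[symmetric] algebra_simps)
    then show "ennreal (exp (inner_Rn n \<phi> y)) * indicator K y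
        = ennreal (exp (t * s)) * (ennreal (exp (t * (inner_Rn n \<theta> y - s))) * indicator K y)"
      by (simp add: ennreal_mult mult.assoc)
  qed
  also have "\<dots> = ennreal (exp (t * s)) * (\<integral>\<^sup>+y. ennreal (exp (t * (inner_Rn n \<theta> y - s))) * indicator K y \<partial>lborel_Rn n)"
    by (intro nn_integral_cmult) measurable
  also have "\<dots> / ennreal ?V \<le> ennreal (exp (t * s)) * ennreal (exp 1 * sqrt (real n) * cap_volume n K \<theta> s) / ennreal ?V"
    by (intro divide_right_mono_ennreal mult_left_mono t) simp
  also have "\<dots> = ennreal (exp (t * s) * (exp 1 * sqrt (real n) * (cap_volume n K \<theta> s / ?V)))"
    using V(2) by (simp add: ennreal_mult[symmetric] divide_ennreal cap_volume_def)
  finally have 1: "laplace n K \<phi> \<le> exp (t * s) * (exp 1 * sqrt (real n) * (cap_volume n K \<theta> s / ?V))"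
    using V(2) by (subst (asm) ennreal_le_iff) (auto simp: cap_volume_def)
  note Hs = closed_halfspace_sets[OF H(1)]
  have "K \<inter> H = cap n K \<theta> a"
    using convex_body_subset_Rn[OF K] unfolding Heq cap_def by blast
  then have "measure (uniform_prob n K) H = cap_volume n K \<theta> a / ?V"
    unfolding uniform_prob_def cap_volume_def
    using V Hs by (subst measure_uniform_measure) auto
  then have "cap_volume n K \<theta> s / ?V \<le> measure (uniform_prob n K) H"
    using cap_volume_antimono[OF K as, of \<theta>] V(2) by (simp add: divide_right_mono)
  then have "exp (t * s) * (exp 1 * sqrt (real n) * (cap_volume n K \<theta> s / ?V))
      \<le> exp (t * s) * (exp 1 * sqrt (real n) * measure (uniform_prob n K) H)"
    by (intro mult_left_mono) auto
  with 1 have "laplace n K \<phi> \<le> exp (inner_Rn n \<phi> x) * (exp 1 * sqrt (real n) * measure (uniform_prob n K) H)"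
    by (simp add: in\<phi> s_def)
  then show ?thesis using \<phi> by blast
qed

lemma tukey_body_lower_bound:
  assumes K: "convex_body n K" and n: "1 \<le> n" and x: "x \<in> Rn_topology n interior_of K"
    and r: "cramer_body n K x = ereal r"
  shows "exp (- r) / (exp 1 * sqrt (real n)) \<le> tukey_body n K x"
  unfolding tukey_depth_def
proof (rule cINF_greatest)
  note xn = interior_of_Rn[OF x]
  show "{H. closed_halfspace n H \<and> x \<in> H} \<noteq> {}"
    using closed_halfspace_through[OF n xn] by blast
next
  fix H assume "H \<in> {H. closed_halfspace n H \<and> x \<in> H}"
  then obtain \<phi> where \<phi>: "\<phi> \<in> Rn n"
    "laplace n K \<phi> \<le> exp (inner_Rn n \<phi> x) * (exp 1 * sqrt (real n) * measure (uniform_prob n K) H)"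
    using laplace_le_halfspace_measure[OF K n x, of H] by blast
  have "ereal (inner_Rn n \<phi> x - ln (laplace n K \<phi>)) \<le> ereal r"
    unfolding r[symmetric] cramer_body_eq[OF K] by (rule SUP_upper[OF \<phi>(1)])
  then have "inner_Rn n \<phi> x - r \<le> ln (laplace n K \<phi>)" by simp
  then have "exp (inner_Rn n \<phi> x - r) \<le> laplace n K \<phi>"
    using nn_integral_uniform_prob_exp(2)[OF K, of \<phi>] by (simp add: ln_ge_iff)
  then have "exp (inner_Rn n \<phi> x) * exp (- r) \<le> exp (inner_Rn n \<phi> x) * (exp 1 * sqrt (real n) * measure (uniform_prob n K) H)"
    using \<phi>(2) by (simp only: exp_add[symmetric] add_uminus_conv_diff)
  then have "exp (- r) \<le> exp 1 * sqrt (real n) * measure (uniform_prob n K) H"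
    by (rule mult_left_le_imp_le) simp
  then show "exp (- r) / (exp 1 * sqrt (real n)) \<le> measure (uniform_prob n K) H"
    using n by (simp add: divide_le_eq mult.commute)
qed

lemma cramer_body_le_tukey:
  assumes K: "convex_body n K" and n: "1 \<le> n" and x: "x \<in> Rn n" and q: "0 < tukey_body n K x"
  shows "cramer_body n K x \<le> ereal (- ln (tukey_body n K x))"
  unfolding cramer_body_eq[OF K]
proof (rule SUP_least)
  fix \<theta> assume \<theta>: "\<theta> \<in> Rn n"
  have "ln (tukey_body n K x) \<le> ln (exp (- inner_Rn n \<theta> x) * laplace n K \<theta>)"
    using tukey_body_le_laplace[OF K n x \<theta>] q by simp
  also have "\<dots> = - inner_Rn n \<theta> x + ln (laplace n K \<theta>)"
    using nn_integral_uniform_prob_exp(2)[OF K, of \<theta>] by (simp add: ln_mult)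
  finally show "ereal (inner_Rn n \<theta> x - ln (laplace n K \<theta>)) \<le> ereal (- ln (tukey_body n K x))" by simp
qed

lemma cramer_body_nonneg:
  assumes K: "convex_body n K"
  shows "0 \<le> cramer_body n K x"
proof -
  interpret prob_space "uniform_prob n K" by (rule prob_space_uniform_prob[OF K])
  define z where "z = (\<lambda>i\<in>{..<n}. 0 :: real)"
  have z: "z \<in> Rn n" "inner_Rn n z y = 0" for y by (auto simp: z_def inner_Rn_def)
  then have "0 = ereal (inner_Rn n z x - ln (laplace n K z))"
    by (simp add: laplace_def emeasure_space_1 zero_ereal_def)
  also have "\<dots> \<le> (SUP \<theta>\<in>Rn n. ereal (inner_Rn n \<theta> x - ln (laplace n K \<theta>)))"
    by (rule SUP_upper[OF z(1)])
  finally show ?thesis unfolding cramer_body_eq[OF K] .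
qed

theorem theorem1p1:
  shows "(\<exists>C::real. C > 0 \<and>
           (\<forall>n\<ge>1. \<forall>K x. convex_body n K \<longrightarrow> x \<in> Rn_topology n interior_of K \<longrightarrow>
              ereal (tukey_body n K x) \<ge> ereal (C / sqrt (real n)) * eexp (- cramer_body n K x)))
       \<and> (\<exists>C'::real. C' > 0 \<and>
           (\<forall>n\<ge>1. \<forall>K x. convex_body n K \<longrightarrow> x \<in> Rn_topology n interior_of K \<longrightarrow>
              cramer_body n K x \<le> - elog (ereal (tukey_body n K x)) \<and>
              - elog (ereal (tukey_body n K x)) \<le> cramer_body n K x + ereal (1/2 * ln (real n) + C')))"
proof -
  have lower: "ereal (exp (- 1) / sqrt (real n)) * eexp (- cramer_body n K x) \<le> ereal (tukey_body n K x)"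
    if n: "1 \<le> n" and K: "convex_body n K" and x: "x \<in> Rn_topology n interior_of K" for n K x
  proof (cases "cramer_body n K x")
    case (real r)
    have "exp (- 1) / sqrt (real n) * exp (- r) = exp (- r) / (exp 1 * sqrt (real n))"
      by (simp add: exp_minus field_simps)
    then show ?thesis using tukey_body_lower_bound[OF K n x real] by (simp add: real eexp_def)
  next
    case PInf
    then show ?thesis using tukey_body_nonneg[OF n interior_of_Rn[OF x], of K] by (simp add: eexp_def)
  next
    case MInf
    then show ?thesis using cramer_body_nonneg[OF K, of x] by simp
  qed
  have chernoff: "cramer_body n K x \<le> - elog (ereal (tukey_body n K x))"
    if n: "1 \<le> n" and K: "convex_body n K" and x: "x \<in> Rn_topology n interior_of K" for n K x
    using cramer_body_le_tukey[OF K n interior_of_Rn[OF x]] by (auto simp: elog_def)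
  have upper: "- elog (ereal (tukey_body n K x)) \<le> cramer_body n K x + ereal (1 / 2 * ln (real n) + 1)"
    if n: "1 \<le> n" and K: "convex_body n K" and x: "x \<in> Rn_topology n interior_of K" for n K x
  proof (cases "cramer_body n K x")
    case (real r)
    define q where "q = exp (- r) / (exp 1 * sqrt (real n))"
    have q: "0 < q" "q \<le> tukey_body n K x"
      using n tukey_body_lower_bound[OF K n x real] by (auto simp: q_def)
    have "- r - (1 + ln (real n) / 2) = ln q"
      using n by (simp add: q_def ln_div ln_mult ln_sqrt)
    also have "\<dots> \<le> ln (tukey_body n K x)" using q by simp
    finally show ?thesis using q by (simp add: real elog_def)
  next
    case PInf
    then show ?thesis by simp
  next
    case MInf
    then show ?thesis using cramer_body_nonneg[OF K, of x] by simp
  qed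
  show ?thesis
  proof (rule conjI)
    show "\<exists>C::real. C > 0 \<and>
           (\<forall>n\<ge>1. \<forall>K x. convex_body n K \<longrightarrow> x \<in> Rn_topology n interior_of K \<longrightarrow>
              ereal (tukey_body n K x) \<ge> ereal (C / sqrt (real n)) * eexp (- cramer_body n K x))"
      by (rule exI[of _ "exp (- 1)"], intro conjI allI impI exp_gt_zero) (rule lower)
    show "\<exists>C'::real. C' > 0 \<and>
           (\<forall>n\<ge>1. \<forall>K x. convex_body n K \<longrightarrow> x \<in> Rn_topology n interior_of K \<longrightarrow>
              cramer_body n K x \<le> - elog (ereal (tukey_body n K x)) \<and>
              - elog (ereal (tukey_body n K x)) \<le> cramer_body n K x + ereal (1/2 * ln (real n) + C'))"
      by (rule exI[of _ 1], intro conjI allI impI zero_less_one) (rule chernoff upper; assumption)+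
  qed
qed

end
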